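(* For the Bounded Cost Minimum Diameter Edge Addition problem restricted to unit costs (with budget $B=k$), there exists a $(k,4)$-approximation algorithm with running time $O(kn^2)$, where $n$ is the number of vertices of the input graph.
   Context: Bounded Cost Minimum Diameter Edge Addition: input is an undirected graph $G=(V,E)$, a weight function $w:[V]^2\to\mathbb{N}$, a cost function $c:[V]^2\to\mathbb{N}^*$ (where $[V]^2$ is the set of unordered vertex pairs) and an integer $B$; the goal is a set $F$ of non-edges of $G$ with $\sum_{e\in F}c(e)\le B$ minimizing the diameter (largest shortest-path distance, path weight = sum of edge weights under $w$) of $(V,E\cup F)$; $D^B_{opt}$ denotes this minimum. In the unit-cost restriction $c\equiv1$, so one may add at most $k=B$ non-edges. An $(\alpha,\beta)$-approximation algorithm computes a set $F$ of non-edges of total cost at most $\alpha\cdot B$ such that the diameter of $(V,E\cup F)$ is at most $\beta\cdot D^B_{opt}$. *)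

theory Defs
  imports "HOL-Library.Extended_Nat" "HOL-Library.Ramsey"
begin

section \<open>Bounded Cost Minimum Diameter Edge Addition\<close>

text \<open>
  Unordered pairs are two-element sets; \<open>[V]\<^bsup>2\<^esup>\<close> is the notation for \<^const>\<open>nsets\<close>.
  Weights and costs matter only on \<open>[V]\<^bsup>2\<^esup>\<close>.
\<close>

record 'a bcmd =
  verts :: "'a set"
  edges :: "'a set set"
  weight :: "'a set \<Rightarrow> nat"
  cost :: "'a set \<Rightarrow> nat"
  budget :: nat

definition bcmd_instance :: "'a bcmd \<Rightarrow> bool" where
  "bcmd_instance I \<longleftrightarrow>
     finite (verts I) \<and> edges I \<subseteq> [verts I]\<^bsup>2\<^esup> \<and> (\<forall>e \<in> [verts I]\<^bsup>2\<^esup>. cost I e > 0)"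

definition unit_cost :: "'a bcmd \<Rightarrow> bool" where
  "unit_cost I \<longleftrightarrow> (\<forall>e \<in> [verts I]\<^bsup>2\<^esup>. cost I e = 1)"

definition non_edges :: "'a bcmd \<Rightarrow> 'a set set" where
  "non_edges I = [verts I]\<^bsup>2\<^esup> - edges I"

fun path_edges :: "'a list \<Rightarrow> 'a set list" where
  "path_edges (x # y # p) = {x, y} # path_edges (y # p)"
| "path_edges p = []"

definition is_path :: "'a set \<Rightarrow> 'a set set \<Rightarrow> 'a \<Rightarrow> 'a list \<Rightarrow> 'a \<Rightarrow> bool" where
  "is_path V E u p v \<longleftrightarrow>
     p \<noteq> [] \<and> hd p = u \<and> last p = v \<and> distinct p \<and> set p \<subseteq> V \<and> set (path_edges p) \<subseteq> E"

definition path_weight :: "('a set \<Rightarrow> nat) \<Rightarrow> 'a list \<Rightarrow> nat" where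
  "path_weight w p = sum_list (map w (path_edges p))"

text \<open>
  Distances take values in \<^typ>\<open>enat\<close>: they are \<open>\<infinity>\<close> between different components, so a
  disconnected graph has diameter \<open>\<infinity>\<close>.
\<close>

definition distance :: "'a set \<Rightarrow> 'a set set \<Rightarrow> ('a set \<Rightarrow> nat) \<Rightarrow> 'a \<Rightarrow> 'a \<Rightarrow> enat" where
  "distance V E w u v = (INF p \<in> {p. is_path V E u p v}. enat (path_weight w p))"

definition diameter :: "'a set \<Rightarrow> 'a set set \<Rightarrow> ('a set \<Rightarrow> nat) \<Rightarrow> enat" where
  "diameter V E w = (SUP u \<in> V. SUP v \<in> V. distance V E w u v)"

definition diameter_with :: "'a bcmd \<Rightarrow> 'a set set \<Rightarrow> enat" where
  "diameter_with I F = diameter (verts I) (edges I \<union> F) (weight I)"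

definition feasible :: "'a bcmd \<Rightarrow> 'a set set \<Rightarrow> bool" where
  "feasible I F \<longleftrightarrow> F \<subseteq> non_edges I \<and> (\<Sum>e\<in>F. cost I e) \<le> budget I"

definition D_opt :: "'a bcmd \<Rightarrow> enat" where
  "D_opt I = (INF F \<in> {F. feasible I F}. diameter_with I F)"

definition approx_solution :: "nat \<Rightarrow> nat \<Rightarrow> 'a bcmd \<Rightarrow> 'a set set \<Rightarrow> bool" where
  "approx_solution \<alpha> \<beta> I F \<longleftrightarrow>
     F \<subseteq> non_edges I \<and> (\<Sum>e\<in>F. cost I e) \<le> \<alpha> * budget I \<and>
     diameter_with I F \<le> enat \<beta> * D_opt I"


section \<open>Random access machine programs and their running time\<close>

text \<open>
  Structured programs over a random access memory that holds natural numbers, under the uniform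
  cost criterion. Memory is split into named arrays, of which a fixed program uses only finitely
  many; a scalar is an array used at address 0 only. Arithmetic is restricted to addition and
  truncated subtraction. Every node of an evaluated expression and every executed command costs
  one time unit, and nothing outside the program text is evaluated for free.
\<close>

datatype aexp = Const nat | Read string aexp | Add aexp aexp | Sub aexp aexp

datatype bexp = Less aexp aexp | Not bexp | And bexp bexp

datatype com =
    Skip
  | Write string aexp aexp
  | Seq com com
  | If bexp com com
  | While bexp com

type_synonym store = "string \<Rightarrow> nat \<Rightarrow> nat"

fun aval :: "aexp \<Rightarrow> store \<Rightarrow> nat" where
  "aval (Const m) s = m"
| "aval (Read x i) s = s x (aval i s)"
| "aval (Add a b) s = aval a s + aval b s"
| "aval (Sub a b) s = aval a s - aval b s"

fun acost :: "aexp \<Rightarrow> nat" where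
  "acost (Const m) = 1"
| "acost (Read x i) = 1 + acost i"
| "acost (Add a b) = 1 + acost a + acost b"
| "acost (Sub a b) = 1 + acost a + acost b"

fun bval :: "bexp \<Rightarrow> store \<Rightarrow> bool" where
  "bval (Less a b) s \<longleftrightarrow> aval a s < aval b s"
| "bval (Not b) s \<longleftrightarrow> \<not> bval b s"
| "bval (And b c) s \<longleftrightarrow> bval b s \<and> bval c s"

fun bcost :: "bexp \<Rightarrow> nat" where
  "bcost (Less a b) = 1 + acost a + acost b"
| "bcost (Not b) = 1 + bcost b"
| "bcost (And b c) = 1 + bcost b + bcost c"

text \<open>
  \<open>exec c s t s'\<close>: started in store \<open>s\<close>, program \<open>c\<close> halts after exactly \<open>t\<close> time units in
  store \<open>s'\<close>. \<open>Write x i a\<close> stores the value of \<open>a\<close> in array \<open>x\<close> at the address given by \<open>i\<close>.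
\<close>

inductive exec :: "com \<Rightarrow> store \<Rightarrow> nat \<Rightarrow> store \<Rightarrow> bool" where
  exec_Skip: "exec Skip s 1 s"
| exec_Write:
    "exec (Write x i a) s (1 + acost i + acost a) (s(x := (s x)(aval i s := aval a s)))"
| exec_Seq:
    "exec c s t s' \<Longrightarrow> exec d s' u s'' \<Longrightarrow> exec (Seq c d) s (1 + t + u) s''"
| exec_IfTrue:
    "bval b s \<Longrightarrow> exec c s t s' \<Longrightarrow> exec (If b c d) s (1 + bcost b + t) s'"
| exec_IfFalse:
    "\<not> bval b s \<Longrightarrow> exec d s t s' \<Longrightarrow> exec (If b c d) s (1 + bcost b + t) s'"
| exec_WhileFalse:
    "\<not> bval b s \<Longrightarrow> exec (While b c) s (1 + bcost b) s"
| exec_WhileTrue: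
    "bval b s \<Longrightarrow> exec c s t s' \<Longrightarrow> exec (While b c) s' u s'' \<Longrightarrow>
     exec (While b c) s (1 + bcost b + t + u) s''"

inductive_cases exec_SkipE: "exec Skip s t s'"
inductive_cases exec_WriteE: "exec (Write x i a) s t s'"
inductive_cases exec_SeqE: "exec (Seq c d) s t s'"
inductive_cases exec_IfE: "exec (If b c d) s t s'"
inductive_cases exec_WhileE: "exec (While b c) s t s'"

lemma exec_deterministic:
  "exec c s t s' \<Longrightarrow> exec c s u s'' \<Longrightarrow> t = u \<and> s' = s''"
proof (induction arbitrary: u s'' rule: exec.induct)
  case (exec_Skip s)
  from exec_Skip.prems show ?case by (rule exec_SkipE) simp
next
  case (exec_Write x i a s)
  from exec_Write.prems show ?case by (rule exec_WriteE) simp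
next
  case (exec_Seq c s t s' d v s'')
  from exec_Seq.prems show ?case
    by (rule exec_SeqE) (metis exec_Seq.IH One_nat_def plus_1_eq_Suc add_Suc)
next
  case (exec_IfTrue b s c t s' d)
  from exec_IfTrue.prems show ?case
    by (rule exec_IfE) (metis exec_IfTrue.IH exec_IfTrue.hyps(1) plus_1_eq_Suc add_Suc)+
next
  case (exec_IfFalse b s d t s' c)
  from exec_IfFalse.prems show ?case
    by (rule exec_IfE) (metis exec_IfFalse.IH exec_IfFalse.hyps(1) plus_1_eq_Suc add_Suc)+
next
  case (exec_WhileFalse b s c)
  from exec_WhileFalse.prems show ?case
    by (rule exec_WhileE) (metis exec_WhileFalse.hyps plus_1_eq_Suc)+
next
  case (exec_WhileTrue b s c t s' v s'')
  from exec_WhileTrue.prems show ?case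
    by (rule exec_WhileE) (metis exec_WhileTrue.IH exec_WhileTrue.hyps(1) plus_1_eq_Suc add_Suc)+
qed


section \<open>Approximation algorithms\<close>

text \<open>
  Algorithms receive graphs with vertex set \<open>{0, \<dots>, n - 1}\<close>. Adjacency, weights and costs are
  given as \<open>n \<times> n\<close> matrices in row-major order: address \<open>i * n + j\<close> with \<open>i, j < n\<close> belongs to the
  pair \<open>{i, j}\<close>. All other memory cells are initially 0.
\<close>

definition standard_instance :: "nat bcmd \<Rightarrow> bool" where
  "standard_instance I \<longleftrightarrow> bcmd_instance I \<and> verts I = {..<card (verts I)}"

definition input_store :: "nat bcmd \<Rightarrow> store" where
  "input_store I = (\<lambda>x a.
     let n = card (verts I); e = {a div n, a mod n} in
       if x = ''n'' \<and> a = 0 then n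
       else if x = ''B'' \<and> a = 0 then budget I
       else if x = ''E'' \<and> e \<in> edges I then 1
       else if x = ''w'' \<and> e \<in> [verts I]\<^bsup>2\<^esup> then weight I e
       else if x = ''c'' \<and> e \<in> [verts I]\<^bsup>2\<^esup> then cost I e
       else 0)"

text \<open>
  The output is a list of unordered pairs: its length is in scalar \<open>m\<close>, and the endpoints of the
  pair at position \<open>r\<close> are in the arrays \<open>x\<close> and \<open>y\<close>.
\<close>

definition output_set :: "store \<Rightarrow> nat set set" where
  "output_set s = {{s ''x'' r, s ''y'' r} | r. r < s ''m'' 0}"

text \<open>
  The guarantees \<open>\<alpha>\<close> and \<open>\<beta>\<close> may depend on the instance; \<open>P\<close> is the class of instances to which
  the problem is restricted. One program has to work for all instances.
\<close>

definition approximation_algorithm ::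
    "(nat bcmd \<Rightarrow> bool) \<Rightarrow> (nat bcmd \<Rightarrow> nat) \<Rightarrow> (nat bcmd \<Rightarrow> nat) \<Rightarrow> com \<Rightarrow> bool" where
  "approximation_algorithm P \<alpha> \<beta> c \<longleftrightarrow>
     (\<forall>I. standard_instance I \<and> P I \<longrightarrow>
        (\<exists>t s. exec c (input_store I) t s \<and> approx_solution (\<alpha> I) (\<beta> I) I (output_set s)))"

definition runs_in_time :: "(nat bcmd \<Rightarrow> bool) \<Rightarrow> (nat bcmd \<Rightarrow> nat) \<Rightarrow> com \<Rightarrow> bool" where
  "runs_in_time P T c \<longleftrightarrow>
     (\<forall>I. standard_instance I \<and> P I \<longrightarrow> (\<exists>t s. exec c (input_store I) t s \<and> t \<le> T I))"

end

(*
Let D be the optimal diameter, attained by adding a set F of at most k non-edges. Adding a single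
edge to a graph lowers the maximum number of vertices with pairwise distances greater than D by at
most one, so at most k + 1 vertices have pairwise distances greater than D in G. Hence farthest-first
traversal finds centers c_0, ..., c_k such that every vertex has distance at most D in G from one of
them. In G + F the distance from c_0 to c_i is at most D, realized by a path with at most k non-edges.
Adding the at most k non-edges of a lightest such path for each i = 1, ..., k costs at most k * k and
makes all distances at most D + D + D + D.
The k + 1 multi-source Dijkstra runs of the traversal take O(n^2) each, and so does each of the k
layers of the dynamic program over the number of non-edges used. A budget above n can be lowered to n,
because simple paths have fewer than n edges.
*)
theory Submission
  imports Defs
begin

section \<open>Total correctness with running time\<close>

text \<open>One routine does the work: \<open>settle\<close> replaces arbitrary start labels
  \<open>d0\<close> by the labels \<open>min_u (d0 u + dist u v)\<close>. The traversal feeds it the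
  old labels with the new center set to 0; each layer of the dynamic program feeds it the labels
  obtained by crossing one more non-edge. Its result is described by two one-sided facts instead of
  a minimum. Along every edge a label grows by at most the weight, so labels stay below path
  weights; this bounds them against an optimal set that the program never sees. And every label is
  realised by some start vertex; this turns a label into edges to add. Labels are naturals while
  distances may be infinite, hence a cap \<open>M\<close> above the weight of every simple path.
  Distances are defined by simple paths while the layers compose walks; the traceback therefore
  never builds a path, but only adds up distances by the triangle inequality.\<close>

definition run :: "com \<Rightarrow> store \<Rightarrow> (nat \<Rightarrow> store \<Rightarrow> bool) \<Rightarrow> bool" where
  "run c s Q \<longleftrightarrow> (\<exists>t s'. exec c s t s' \<and> Q t s')"

lemma run_mono: "run c s Q \<Longrightarrow> (\<And>t s'. Q t s' \<Longrightarrow> Q' t s') \<Longrightarrow> run c s Q'"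
  unfolding run_def by blast

lemma run_mono': "run c s Q \<Longrightarrow> s' = s \<Longrightarrow> (\<And>t r. Q t r \<Longrightarrow> Q' t r) \<Longrightarrow> run c s' Q'"
  using run_mono by blast

lemma run_Skip: "run Skip s Q \<longleftrightarrow> Q 1 s"
  unfolding run_def by (metis exec_Skip exec_SkipE)

lemma run_Write:
  "run (Write x i a) s Q \<longleftrightarrow> Q (1 + acost i + acost a) (s(x := (s x)(aval i s := aval a s)))"
  unfolding run_def by (metis exec_Write exec_WriteE)

lemma run_Seq: "run (Seq c d) s Q \<longleftrightarrow> run c s (\<lambda>t s'. run d s' (\<lambda>u. Q (1 + t + u)))"
proof
  assume "run (Seq c d) s Q"
  then obtain t s' where "exec (Seq c d) s t s'" and Q: "Q t s'"
    unfolding run_def by blast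
  from this(1) obtain ta u r where *: "t = 1 + ta + u" "exec c s ta r" "exec d r u s'"
    by (rule exec_SeqE) auto
  show "run c s (\<lambda>t s'. run d s' (\<lambda>u. Q (1 + t + u)))"
    unfolding run_def using * Q by blast
next
  assume "run c s (\<lambda>t s'. run d s' (\<lambda>u. Q (1 + t + u)))"
  then obtain t s' u s'' where "exec c s t s'" "exec d s' u s''" "Q (1 + t + u) s''"
    unfolding run_def by blast
  then show "run (Seq c d) s Q"
    unfolding run_def using exec_Seq by blast
qed

lemma run_If:
  "run (If b c d) s Q \<longleftrightarrow>
     (if bval b s then run c s (\<lambda>t. Q (1 + bcost b + t)) else run d s (\<lambda>t. Q (1 + bcost b + t)))"
proof
  assume "run (If b c d) s Q"
  then obtain t s' where "exec (If b c d) s t s'" and Q: "Q t s'"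
    unfolding run_def by blast
  from this(1) show "if bval b s then run c s (\<lambda>t. Q (1 + bcost b + t))
      else run d s (\<lambda>t. Q (1 + bcost b + t))"
    by (rule exec_IfE) (use Q in \<open>simp_all, unfold run_def, auto\<close>)
next
  assume *: "if bval b s then run c s (\<lambda>t. Q (1 + bcost b + t))
      else run d s (\<lambda>t. Q (1 + bcost b + t))"
  show "run (If b c d) s Q"
  proof (cases "bval b s")
    case True
    then obtain t s' where "exec c s t s'" "Q (1 + bcost b + t) s'"
      using * unfolding run_def by auto
    then show ?thesis unfolding run_def using exec_IfTrue[OF True] by blast
  next
    case False
    then obtain t s' where "exec d s t s'" "Q (1 + bcost b + t) s'"
      using * unfolding run_def by auto
    then show ?thesis unfolding run_def using exec_IfFalse[OF False] by blast
  qed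
qed

fun writes :: "com \<Rightarrow> string set" where
  "writes Skip = {}"
| "writes (Write x i a) = {x}"
| "writes (Seq c d) = writes c \<union> writes d"
| "writes (If b c d) = writes c \<union> writes d"
| "writes (While b c) = writes c"

lemma exec_frame: "exec c s t s' \<Longrightarrow> x \<notin> writes c \<Longrightarrow> s' x = s x"
  by (induction rule: exec.induct) auto

text \<open>Arrays outside \<open>writes c\<close> keep their contents, so the specification of a
  program need only mention what it writes; everything else about the store is recovered here when
  the specification is applied.\<close>

lemma run_frame:
  "run c s Q \<Longrightarrow> (\<And>t s'. Q t s' \<Longrightarrow> (\<And>x. x \<notin> writes c \<Longrightarrow> s' x = s x) \<Longrightarrow> Q' t s') \<Longrightarrow> run c s Q'"
  unfolding run_def using exec_frame by metis

abbreviation Scalar :: "string \<Rightarrow> aexp" where "Scalar x \<equiv> Read x (Const 0)"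

abbreviation assign :: "string \<Rightarrow> aexp \<Rightarrow> com" where "assign x a \<equiv> Write x (Const 0) a"

definition For :: "string \<Rightarrow> aexp \<Rightarrow> com \<Rightarrow> com" where
  "For x b c = Seq (assign x (Const 0))
     (While (Less (Scalar x) b) (Seq c (assign x (Add (Scalar x) (Const 1)))))"

lemma writes_For [simp]: "writes (For x b c) = insert x (writes c)"
  by (auto simp: For_def)

text \<open>A round costs at most \<open>T + 15\<close>: 8 for the test (a bound such as
  \<open>K + 1\<close> costs 4), \<open>T\<close> for the body, 7 for sequencing and increment.
  Initialisation and the last test add 12, which \<open>N >= 1\<close> lets the constant 30
  absorb.\<close>

lemma run_For:
  assumes x: "x \<notin> writes c"
    and b: "\<And>s'. (\<And>y. y \<notin> insert x (writes c) \<Longrightarrow> s' y = s y) \<Longrightarrow> aval b s' = N"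
    and N: "N \<ge> 1" "acost b \<le> 4"
    and init: "I 0 (s(x := (s x)(0 := 0)))"
    and body: "\<And>i s'. i < N \<Longrightarrow> I i s' \<Longrightarrow> s' x 0 = i \<Longrightarrow>
        (\<And>y. y \<notin> insert x (writes c) \<Longrightarrow> s' y = s y) \<Longrightarrow>
        run c s' (\<lambda>t s''. t \<le> T \<and> I (Suc i) (s''(x := (s'' x)(0 := Suc i))))"
    and Q: "\<And>t s'. t \<le> N * (T + 30) \<Longrightarrow> I N s' \<Longrightarrow>
        (\<And>y. y \<notin> insert x (writes c) \<Longrightarrow> s' y = s y) \<Longrightarrow> Q t s'"
  shows "run (For x b c) s Q"
proof -
  let ?frame = "\<lambda>s'. \<forall>y. y \<notin> insert x (writes c) \<longrightarrow> s' y = s y"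
  let ?W = "While (Less (Scalar x) b) (Seq c (assign x (Add (Scalar x) (Const 1))))"
  have loop: "\<exists>t s''. exec ?W s' t s'' \<and> t \<le> 8 + (N - i) * (T + 15) \<and> I N s'' \<and> ?frame s''"
    if "i \<le> N" "I i s'" "s' x 0 = i" "?frame s'" for i s'
    using that
  proof (induction "N - i" arbitrary: i s')
    case 0
    then have "\<not> bval (Less (Scalar x) b) s'" using b[of s'] by simp
    then show ?case
      using exec_WhileFalse[of "Less (Scalar x) b" s'] 0 N(2) by (intro exI conjI) auto
  next
    case (Suc m)
    then have i: "i < N" by simp
    have B: "bval (Less (Scalar x) b) s'" using b[of s'] Suc.prems i by simp
    obtain t u where u: "exec c s' t u" "t \<le> T" "I (Suc i) (u(x := (u x)(0 := Suc i)))"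
      using body[OF i, of s'] Suc.prems unfolding run_def by auto
    have fr: "u y = s' y" if "y \<notin> writes c" for y using exec_frame[OF u(1) that] .
    let ?u = "u(x := (u x)(0 := Suc i))"
    have "u x 0 = i" using fr[OF x] Suc.prems by simp
    then have 1: "exec (Seq c (assign x (Add (Scalar x) (Const 1)))) s' (1 + t + 6) ?u"
      using exec_Seq[OF u(1) exec_Write[of x "Const 0" "Add (Scalar x) (Const 1)" u]]
      by (simp add: eval_nat_numeral)
    have "?frame ?u" using fr Suc.prems(4) by simp
    have m: "m = N - Suc i" using Suc.hyps(2) by simp
    obtain t' s'' where 2: "exec ?W ?u t' s''" "t' \<le> 8 + (N - Suc i) * (T + 15)"
        "I N s''" "?frame s''"
      using Suc.hyps(1)[OF m Suc_leI[OF i] u(3) _ \<open>?frame ?u\<close>] fun_upd_same by metis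
    have ni: "N - i = Suc (N - Suc i)" using i by simp
    have "1 + bcost (Less (Scalar x) b) + (1 + t + 6) + t' \<le> 8 + (N - i) * (T + 15)"
      using 2(2) u(2) N(2) unfolding ni by simp
    then show ?case using exec_WhileTrue[OF B 1 2(1)] 2 by blast
  qed
  let ?s = "s(x := (s x)(0 := 0))"
  obtain t s' where s': "exec ?W ?s t s'" "t \<le> 8 + N * (T + 15)" "I N s'" "?frame s'"
    using loop[of 0 ?s] init by auto
  have "exec (For x b c) s (1 + (1 + 1 + 1) + t) s'"
    unfolding For_def using exec_Seq[OF exec_Write[of x "Const 0" "Const 0" s]] s'(1) by simp
  moreover have "1 + (1 + 1 + 1) + t \<le> N * (T + 30)"
    using s'(2) N(1) by (simp add: algebra_simps)
  ultimately show ?thesis using Q s' unfolding run_def by blast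
qed

section \<open>Distances\<close>

lemma is_path_simps:
  "\<not> is_path V E u [] v"
  "is_path V E u [a] v \<longleftrightarrow> a = u \<and> a = v \<and> a \<in> V"
  "is_path V E u (a # b # p) v \<longleftrightarrow>
     a = u \<and> a \<in> V \<and> {a, b} \<in> E \<and> a \<notin> set (b # p) \<and> is_path V E b (b # p) v"
  by (auto simp: is_path_def)

lemma path_weight_simps [simp]:
  "path_weight w [] = 0"
  "path_weight w [a] = 0"
  "path_weight w (a # b # p) = w {a, b} + path_weight w (b # p)"
  by (auto simp: path_weight_def)

lemma path_edges_append: "path_edges (p @ a # q) = path_edges (p @ [a]) @ path_edges (a # q)"
proof (induction p)
  case (Cons b p)
  then show ?case by (cases p) auto
qed simp

lemma path_edges_subset: "e \<in> set (path_edges p) \<Longrightarrow> e \<subseteq> set p"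
  by (induction p rule: path_edges.induct) auto

lemma distinct_path_edges: "distinct p \<Longrightarrow> distinct (path_edges p)"
  by (induction p rule: path_edges.induct) (auto dest: path_edges_subset)

lemma length_path_edges: "length (path_edges p) \<le> length p"
  by (induction p rule: path_edges.induct) auto

lemma distance_le_path_weight:
  "is_path V E u p v \<Longrightarrow> distance V E w u v \<le> enat (path_weight w p)"
  unfolding distance_def by (rule INF_lower) simp

lemma distance_le_enatE:
  assumes "distance V E w u v \<le> enat d"
  obtains p where "is_path V E u p v" "path_weight w p \<le> d"
proof -
  have "distance V E w u v < enat (Suc d)"
    using assms by (simp add: order_le_less_trans)
  then obtain p where "is_path V E u p v" "enat (path_weight w p) < enat (Suc d)"
    unfolding distance_def INF_less_iff by blast
  then show ?thesis by (intro that[of p]) simp_all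
qed

lemma distance_self: "u \<in> V \<Longrightarrow> distance V E w u u = 0"
  using distance_le_path_weight[of V E u "[u]" u w] by (simp add: is_path_simps flip: zero_enat_def)

text \<open>Paths are simple, so prepending \<open>u\<close> fails when \<open>u\<close> already
  lies on the path from \<open>x\<close>. Then the suffix starting at \<open>u\<close> serves, being
  no heavier because weights are natural numbers. Iterating this step yields the triangle inequality
  without concatenating paths.\<close>

lemma distance_edge_step:
  assumes "u \<in> V" "{u, x} \<in> E"
  shows "distance V E w u v \<le> enat (w {u, x}) + distance V E w x v"
proof (cases "distance V E w x v")
  case (enat m)
  then obtain p where p: "is_path V E x p v" "path_weight w p \<le> m"
    by (rule distance_le_enatE[OF eq_refl])
  have "\<exists>q. is_path V E u q v \<and> path_weight w q \<le> w {u, x} + m"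
  proof (cases "u \<in> set p")
    case True
    then obtain a b where ab: "p = a @ u # b" by (meson split_list)
    have "is_path V E u (u # b) v"
      using p(1) unfolding is_path_def ab path_edges_append[of a u b] by auto
    moreover have "path_weight w (u # b) \<le> path_weight w p"
      unfolding ab path_weight_def path_edges_append[of a u b] by simp
    ultimately show ?thesis using p(2) by (intro exI[of _ "u # b"]) simp
  next
    case False
    obtain q where q: "p = x # q" using p(1) by (cases p) (auto simp: is_path_def)
    show ?thesis using p assms False unfolding q
      by (intro exI[of _ "u # x # q"]) (auto simp: is_path_simps)
  qed
  then obtain q where "is_path V E u q v" "path_weight w q \<le> w {u, x} + m" by blast
  then have "distance V E w u v \<le> enat (w {u, x} + m)"
    by (intro order_trans[OF distance_le_path_weight[of V E u q v w]]) simp_all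
  then show ?thesis using enat by simp
qed simp

lemma distance_edge: "u \<in> V \<Longrightarrow> x \<in> V \<Longrightarrow> {u, x} \<in> E \<Longrightarrow> distance V E w u x \<le> enat (w {u, x})"
  using distance_edge_step[of u V x E w x] by (simp add: distance_self)

lemma distance_path_step:
  "is_path V E u p v \<Longrightarrow> distance V E w u z \<le> enat (path_weight w p) + distance V E w v z"
proof (induction p arbitrary: u rule: path_edges.induct)
  case (1 a b p)
  then have "distance V E w u z \<le> enat (w {a, b}) + distance V E w b z"
    by (auto simp: is_path_simps intro: distance_edge_step)
  also have "\<dots> \<le> enat (w {a, b}) + (enat (path_weight w (b # p)) + distance V E w v z)"
    using 1 by (intro add_left_mono) (auto simp: is_path_simps)
  finally show ?case by (simp flip: add.assoc)
qed (auto simp: is_path_simps simp flip: zero_enat_def)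

lemma distance_triangle:
  "distance V E w u z \<le> distance V E w u v + distance V E w v z"
proof (cases "distance V E w u v")
  case (enat m)
  then obtain p where p: "is_path V E u p v" "path_weight w p \<le> m"
    by (rule distance_le_enatE[OF eq_refl])
  have "distance V E w u z \<le> enat (path_weight w p) + distance V E w v z"
    by (rule distance_path_step[OF p(1)])
  also have "\<dots> \<le> enat m + distance V E w v z" using p(2) by (intro add_right_mono) simp
  finally show ?thesis using enat by simp
qed simp

lemma distance_sym_le: "distance V E w v u \<le> distance V E w u v"
proof -
  have *: "distance V E w v u \<le> enat (path_weight w p)" if "is_path V E u p v" for p
    using that
  proof (induction p arbitrary: u rule: path_edges.induct)
    case (1 a b p)
    then have b: "b \<in> V" by (auto simp: is_path_def)
    have "distance V E w v u \<le> distance V E w v b + distance V E w b u"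
      by (rule distance_triangle)
    also have "\<dots> \<le> enat (path_weight w (b # p)) + enat (w {b, a})"
      using 1 b by (intro add_mono)
        (auto simp: is_path_simps insert_commute intro!: distance_edge)
    finally show ?case by (simp add: insert_commute add.commute)
  qed (auto simp: is_path_simps distance_self)
  show ?thesis unfolding distance_def[of V E w u v] by (rule INF_greatest) (use * in auto)
qed

lemma distance_sym: "distance V E w u v = distance V E w v u"
  by (simp add: antisym distance_sym_le)

lemma distance_mono: "E \<subseteq> E' \<Longrightarrow> distance V E' w u v \<le> distance V E w u v"
  unfolding distance_def by (rule INF_superset_mono) (auto simp: is_path_def)

text \<open>Telescoping along a path. Labels that satisfy all edge constraints thereby bound
  distances from below, however they were computed.\<close>

lemma potential_le_distance:
  assumes closed: "\<And>x y. x \<in> V \<Longrightarrow> y \<in> V \<Longrightarrow> {x, y} \<in> E \<Longrightarrow> d y \<le> d x + w {x, y}"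
  shows "enat (d v) \<le> enat (d u) + distance V E w u v"
proof (cases "distance V E w u v")
  case (enat m)
  then obtain p where p: "is_path V E u p v" "path_weight w p \<le> m"
    by (rule distance_le_enatE[OF eq_refl])
  from p(1) have "d v \<le> d u + path_weight w p"
  proof (induction p arbitrary: u rule: path_edges.induct)
    case (1 a b p)
    then have "d b \<le> d u + w {a, b}" "is_path V E b (b # p) v"
      using closed[of a b] by (auto simp: is_path_simps is_path_def)
    then show ?case using 1(1)[of b] by simp
  qed (auto simp: is_path_simps)
  then show ?thesis using p(2) enat by simp
qed simp

text \<open>Telescoping in a layered graph: an edge of \<open>E\<close> stays in its layer, any
  other edge climbs to the next one. Layers that the path does not reach are bridged at the end by
  antitonicity.\<close>

lemma layered_potential_le_path_weight:
  fixes f :: "nat \<Rightarrow> 'a \<Rightarrow> nat"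
  assumes antimono: "\<And>j v. j < K \<Longrightarrow> v \<in> V \<Longrightarrow> f (Suc j) v \<le> f j v"
    and closed: "\<And>j x y. j \<le> K \<Longrightarrow> x \<in> V \<Longrightarrow> y \<in> V \<Longrightarrow> {x, y} \<in> E \<Longrightarrow> f j y \<le> f j x + w {x, y}"
    and step: "\<And>j x y. j < K \<Longrightarrow> x \<in> V \<Longrightarrow> y \<in> V \<Longrightarrow> {x, y} \<in> F \<Longrightarrow> {x, y} \<notin> E \<Longrightarrow>
                 f (Suc j) y \<le> f j x + w {x, y}"
    and p: "is_path V (E \<union> F) u p v" and K: "length (filter (\<lambda>e. e \<notin> E) (path_edges p)) \<le> K"
  shows "f K v \<le> f 0 u + path_weight w p"
proof -
  let ?q = "\<lambda>p. length (filter (\<lambda>e. e \<notin> E) (path_edges p))"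
  \<comment> \<open>The induction allows a start in any layer \<open>j\<close> that leaves room for
    the non-edges still to come.\<close>
  have "f K v \<le> f j u + path_weight w p"
    if "is_path V (E \<union> F) u p v" "j + ?q p \<le> K" for j u p
    using that
  proof (induction p arbitrary: u j rule: path_edges.induct)
    case (1 a b p)
    have b: "b \<in> V" "a \<in> V" "a = u" "{a, b} \<in> E \<union> F" "is_path V (E \<union> F) b (b # p) v"
      using "1.prems"(1) by (auto simp: is_path_simps is_path_def)
    show ?case
    proof (cases "{a, b} \<in> E")
      case True
      then have "f j b \<le> f j u + w {a, b}" using closed[of j a b] b "1.prems"(2) by auto
      moreover have "f K v \<le> f j b + path_weight w (b # p)"
        using "1.IH"[OF b(5), of j] "1.prems"(2) True by simp
      ultimately show ?thesis by simp
    next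
      case False
      then have "f (Suc j) b \<le> f j u + w {a, b}" using step[of j a b] b "1.prems"(2) by auto
      moreover have "f K v \<le> f (Suc j) b + path_weight w (b # p)"
        using "1.IH"[OF b(5), of "Suc j"] "1.prems"(2) False by simp
      ultimately show ?thesis by simp
    qed
  next
    case ("2_2" a)
    then have "u = v" "v \<in> V" by (auto simp: is_path_simps)
    have "i \<le> K \<Longrightarrow> f i v \<le> f j v" if "j \<le> i" for i
      using that
    proof (induction i rule: dec_induct)
      case (step i)
      then show ?case using antimono[of i v] \<open>v \<in> V\<close> by simp
    qed simp
    then show ?case using \<open>u = v\<close> "2_2" by simp
  qed (auto simp: is_path_simps)
  from this[OF p, of 0] K show ?thesis by simp
qed

text \<open>A simple path leaves each vertex at most once, so each edge is charged to the vertex it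
  leaves. Ordered pairs count every weight twice, but make the bound a plain double loop over the
  weight matrix.\<close>

lemma path_weight_le_sum:
  assumes "finite V" "is_path V E u p v"
  shows "path_weight w p \<le> (\<Sum>x\<in>V. \<Sum>y\<in>V - {x}. w {x, y})"
proof -
  have "path_weight w p \<le> (\<Sum>x\<in>set p. \<Sum>y\<in>V - {x}. w {x, y})"
    using assms(2)
  proof (induction p arbitrary: u rule: path_edges.induct)
    case (1 a b p)
    then have b: "b \<in> V" "a \<notin> set (b # p)" "is_path V E b (b # p) v"
      by (auto simp: is_path_simps is_path_def)
    have "w {a, b} \<le> (\<Sum>y\<in>V - {a}. w {a, y})"
      using b assms(1) by (intro member_le_sum) auto
    moreover have "(\<Sum>x\<in>set (a # b # p). \<Sum>y\<in>V - {x}. w {x, y}) =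
        (\<Sum>y\<in>V - {a}. w {a, y}) + (\<Sum>x\<in>set (b # p). \<Sum>y\<in>V - {x}. w {x, y})"
      unfolding list.set(2)[of a] using b(2) by (intro sum.insert) auto
    ultimately show ?case using "1.IH"[OF b(3)] by simp
  qed auto
  also have "\<dots> \<le> (\<Sum>x\<in>V. \<Sum>y\<in>V - {x}. w {x, y})"
    using assms by (intro sum_mono2) (auto simp: is_path_def)
  finally show ?thesis .
qed

section \<open>Packings\<close>

definition packing :: "'a set \<Rightarrow> 'a set set \<Rightarrow> ('a set \<Rightarrow> nat) \<Rightarrow> nat \<Rightarrow> 'a set \<Rightarrow> bool" where
  "packing V E w r U \<longleftrightarrow> U \<subseteq> V \<and> (\<forall>a\<in>U. \<forall>b\<in>U. a \<noteq> b \<longrightarrow> enat r < distance V E w a b)"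

text \<open>A path avoids the new edge, crosses it from \<open>x\<close> to \<open>y\<close>, or
  crosses it from \<open>y\<close> to \<open>x\<close>. The weight of the new edge is dropped from
  the bounds.\<close>

lemma distance_insert_edge:
  assumes "is_path V (insert {x, y} E) a p b"
  shows "distance V E w a b \<le> enat (path_weight w p) \<or>
    distance V E w a x + distance V E w y b \<le> enat (path_weight w p) \<or>
    distance V E w a y + distance V E w x b \<le> enat (path_weight w p)"
  using assms
proof (induction p arbitrary: a rule: path_edges.induct)
  case (1 a' c p)
  let ?d = "distance V E w" and ?W = "enat (path_weight w (c # p))"
  from 1 have a: "a' = a" "a \<in> V" "{a, c} \<in> insert {x, y} E" "c \<in> V"
    and IH: "?d c b \<le> ?W \<or> ?d c x + ?d y b \<le> ?W \<or> ?d c y + ?d x b \<le> ?W"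
    by (auto simp: is_path_simps is_path_def)
  show ?case
  proof (cases "{a, c} \<in> E")
    case True
    have *: "?d a z + t \<le> enat (path_weight w (a' # c # p))" if "?d c z + t \<le> ?W" for z t
    proof -
      have "?d a z + t \<le> (enat (w {a, c}) + ?d c z) + t"
        by (intro add_right_mono distance_edge_step) (use True a in auto)
      also have "\<dots> \<le> enat (w {a, c}) + ?W"
        unfolding add.assoc by (intro add_left_mono that)
      finally show ?thesis by (simp add: a)
    qed
    show ?thesis
      using IH *[of b 0] *[of x "?d y b"] *[of y "?d x b"] by (simp only: add_0_right) blast
  next
    case False
    have W: "?W \<le> enat (path_weight w (a' # c # p))" by simp
    have inc: "t \<le> ?W" if "z + t \<le> ?W" for z t
      by (rule order_trans[OF add_increasing[OF zero_le order_refl] that])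
    have self: "?d c c = 0" "?d a a = 0" using a by (simp_all add: distance_self)
    from False a(3) consider "a = x" "c = y" | "a = y" "c = x" by (auto simp: doubleton_eq_iff)
    \<comment> \<open>If the induction hypothesis routes the remainder over the new edge, that route
      comes back to \<open>c\<close> or passes through \<open>a\<close>; what follows is a direct
      route to \<open>b\<close> that is no longer.\<close>
    then have "?d a b \<le> ?W \<or> ?d c b \<le> ?W"
      using IH inc[of "?d c x" "?d y b"] inc[of "?d c y" "?d x b"] by cases auto
    then have "?d a b \<le> enat (path_weight w (a' # c # p)) \<or>
        ?d a a + ?d c b \<le> enat (path_weight w (a' # c # p))"
      unfolding self add_0 using W order_trans by blast
    with False a(3) show ?thesis by (auto simp: doubleton_eq_iff)
  qed
qed (auto simp: is_path_simps distance_self)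

text \<open>Two pairs of a packing that an extra edge \<open>xy\<close> brings within distance \<open>r\<close> share the endpoint
  on the side of \<open>x\<close> or the one on the side of \<open>y\<close>, so all such pairs form a star; removing its
  center restores a packing.\<close>

lemma packing_insert_edge:
  assumes U: "packing V E w r U"
  obtains z where "packing V (insert {x, y} E) w r (U - {z})"
proof -
  let ?d = "distance V E w"
  define A where "A a b \<longleftrightarrow> a \<in> U \<and> b \<in> U \<and> a \<noteq> b \<and> ?d a x + ?d y b \<le> enat r" for a b
  have share: "a = c \<or> b = e" if "A a b" "A c e" for a b c e
  proof (rule ccontr)
    assume "\<not> (a = c \<or> b = e)"
    then have "enat r < ?d a c" "enat r < ?d b e"
      using that U by (auto simp: A_def packing_def)
    moreover have "?d a c \<le> ?d a x + ?d c x"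
      using distance_triangle[of V E w a c x] by (simp add: distance_sym)
    moreover have "?d b e \<le> ?d y b + ?d y e"
      using distance_triangle[of V E w b e y] by (simp add: distance_sym)
    moreover have "?d a x + ?d y b \<le> enat r" "?d c x + ?d y e \<le> enat r"
      using that by (auto simp: A_def)
    ultimately have "enat r < ?d a x + ?d c x" "enat r < ?d y b + ?d y e"
        "?d a x + ?d y b \<le> enat r" "?d c x + ?d y e \<le> enat r"
      by (simp_all only: order_less_le_trans)
    \<comment> \<open>The four distances to \<open>x\<close> and \<open>y\<close> add up to more
      than twice \<open>r\<close> in one grouping and to at most twice \<open>r\<close> in the
      other.\<close>
    then show False
      by (cases "?d a x"; cases "?d y b"; simp; cases "?d c x"; cases "?d y e"; simp)
  qed
  have "\<exists>z. \<forall>a b. A a b \<longrightarrow> a = z \<or> b = z"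
  proof (cases "\<exists>a b. A a b")
    case True
    then obtain a b where ab: "A a b" by blast
    show ?thesis
    \<comment> \<open>Either all pairs start at \<open>a\<close>, or a second pair with another
      start must end in \<open>b\<close>; every further pair has to meet both of these and so ends
      in \<open>b\<close> as well.\<close>
    proof (cases "\<exists>c e. A c e \<and> c \<noteq> a")
      case True
      then obtain c e where ce: "A c e" "c \<noteq> a" by blast
      then have "e = b" using share[OF ab ce(1)] by simp
      then have "q = b" if "A p q" for p q
        using share[OF ab that] share[OF ce(1) that] ce(2) by auto
      then show ?thesis by blast
    qed blast
  qed auto
  then obtain z where z: "\<And>a b. A a b \<Longrightarrow> a = z \<or> b = z" by blast
  have "packing V (insert {x, y} E) w r (U - {z})"
    unfolding packing_def
  proof (intro conjI ballI impI, goal_cases)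
    case 1
    then show ?case using U by (auto simp: packing_def)
  next
    case (2 a b)
    show ?case
    proof (rule ccontr)
      assume "\<not> enat r < distance V (insert {x, y} E) w a b"
      then obtain p where p: "is_path V (insert {x, y} E) a p b" "path_weight w p \<le> r"
        using distance_le_enatE by (metis linorder_not_less)
      have "\<not> ?d a b \<le> enat (path_weight w p)"
        using 2 U p(2) unfolding packing_def
        by (metis DiffD1 enat_ord_simps(1) linorder_not_less order_trans)
      then have "?d a x + ?d y b \<le> enat (path_weight w p) \<or> ?d a y + ?d x b \<le> enat (path_weight w p)"
        using distance_insert_edge[OF p(1), of w] by blast
      then have "?d a x + ?d y b \<le> enat r \<or> ?d a y + ?d x b \<le> enat r"
        using p(2) by (meson enat_ord_simps(1) order_trans)
      then have "A a b \<or> A b a"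
        using 2 by (auto simp: A_def distance_sym[of V E w _ a] distance_sym[of V E w b] add.commute)
      then show False using z 2 by blast
    qed
  qed
  then show ?thesis by (rule that)
qed

lemma card_packing_le:
  assumes "finite V" "finite F" "\<And>e. e \<in> F \<Longrightarrow> \<exists>x y. e = {x, y}"
    and "packing V E w r U" "diameter V (E \<union> F) w \<le> enat r"
  shows "card U \<le> Suc (card F)"
  using assms(2-)
proof (induction F arbitrary: E U rule: finite_induct)
  case empty
  have fin: "finite U" using empty assms(1) by (auto simp: packing_def intro: finite_subset)
  have "a = b" if "a \<in> U" "b \<in> U" for a b
  proof (rule ccontr)
    assume "a \<noteq> b"
    then have "enat r < distance V E w a b" "a \<in> V" "b \<in> V"
      using empty that by (auto simp: packing_def)
    moreover have "distance V E w a b \<le> diameter V E w"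
      unfolding diameter_def using \<open>a \<in> V\<close> \<open>b \<in> V\<close> by (meson SUP_upper SUP_upper2)
    ultimately show False using empty by simp
  qed
  then show ?case using fin by (simp add: card_le_Suc0_iff_eq)
next
  case (insert e F)
  then obtain x y where e: "e = {x, y}" by blast
  obtain z where "packing V (insert e E) w r (U - {z})"
    using packing_insert_edge[OF insert.prems(2)] e by metis
  then have "card (U - {z}) \<le> Suc (card F)"
    using insert.IH[of "insert e E" "U - {z}"] insert.prems by auto
  then show ?case using insert.hyps
    by (metis card_Diff_singleton_if card_insert_disjoint le_SucI le_diff_conv add.commute
        plus_1_eq_Suc)
qed

section \<open>Shortest path closure\<close>

locale graph =
  fixes n :: nat and E :: "nat set set" and w :: "nat set \<Rightarrow> nat"
  assumes edges: "E \<subseteq> [{..<n}]\<^bsup>2\<^esup>" and n: "n \<ge> 1"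
begin

abbreviation dist :: "nat \<Rightarrow> nat \<Rightarrow> enat" where "dist \<equiv> distance {..<n} E w"

lemma edge_neq: "{u, v} \<in> E \<Longrightarrow> u \<noteq> v"
  using edges by (auto simp: nsets_def)

definition stored :: "store \<Rightarrow> bool" where
  "stored s \<longleftrightarrow> s ''n'' 0 = n \<and> (\<forall>i\<le>n. s ''r'' i = i * n) \<and>
     (\<forall>i<n. \<forall>j<n. (0 < s ''E'' (i * n + j)) = ({i, j} \<in> E)) \<and>
     (\<forall>i<n. \<forall>j<n. s ''w'' (i * n + j) = (if i = j then 0 else w {i, j}))"

lemma stored_frame:
  assumes "stored s" "s' ''n'' = s ''n''" "s' ''r'' = s ''r''" "s' ''E'' = s ''E''" "s' ''w'' = s ''w''"
  shows "stored s'"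
  using assms by (simp add: stored_def)

text \<open>The labels \<open>p\<close> name the vertex \<open>u\<close> attaining the minimum of \<open>d\<^sub>0 u + dist u v\<close>.\<close>

definition settled :: "(nat \<Rightarrow> bool) \<Rightarrow> (nat \<Rightarrow> nat) \<Rightarrow> (nat \<Rightarrow> nat) \<Rightarrow> (nat \<Rightarrow> nat) \<Rightarrow> (nat \<Rightarrow> nat) \<Rightarrow> bool"
  where
  "settled S d0 p0 d p \<longleftrightarrow> (\<forall>v<n. d v \<le> d0 v) \<and>
     (\<forall>v<n. \<exists>u<n. p v = p0 u \<and> enat (d0 u) + dist u v \<le> enat (d v)) \<and>
     (\<forall>u<n. \<forall>v<n. S u \<longrightarrow> {u, v} \<in> E \<longrightarrow> d v \<le> d u + w {u, v}) \<and>
     (\<forall>u<n. \<forall>v<n. S u \<longrightarrow> \<not> S v \<longrightarrow> d u \<le> d v)"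

text \<open>With every vertex settled, the edge constraints and \<open>d v \<le> d0 v\<close> bound
  the label by each \<open>d0 u + dist u v\<close>, and the witness clause bounds it from below: the
  label is exactly the minimum of these values.\<close>

abbreviation "settled_all \<equiv> settled (\<lambda>_. True)"

lemma settled_init: "settled (\<lambda>_. False) d p d p"
  by (auto simp: settled_def distance_self intro!: exI simp flip: zero_enat_def)

definition improves :: "(nat \<Rightarrow> nat) \<Rightarrow> nat \<Rightarrow> nat \<Rightarrow> bool" where
  "improves d b v \<longleftrightarrow> {b, v} \<in> E \<and> d b + w {b, v} < d v"

text \<open>One round of Dijkstra's algorithm. Weights are nonnegative and \<open>b\<close> has the
  least unsettled label, so relaxing at \<open>b\<close> cannot lower a settled label; the
  constraints already established therefore persist.\<close>

lemma settled_step: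
  assumes inv: "settled S d0 p0 d p"
    and b: "b < n" "\<And>v. v < n \<Longrightarrow> \<not> S v \<Longrightarrow> d b \<le> d v"
    and d': "\<And>v. v < n \<Longrightarrow> d' v = (if improves d b v then d b + w {b, v} else d v)"
    and p': "\<And>v. v < n \<Longrightarrow> p' v = (if improves d b v then p b else p v)"
    and S': "\<And>v. v < n \<Longrightarrow> S' v \<longleftrightarrow> v = b \<or> S v" and b': "\<not> S b"
  shows "settled S' d0 p0 d' p'"
proof -
  have db: "d' b = d b" using d' b edge_neq unfolding improves_def by fastforce
  have le: "d' v \<le> d v" if "v < n" for v using d' that by (auto simp: improves_def)
  have same: "d' u = d u" if "u < n" "S u" for u
  proof -
    have "d u \<le> d b" using inv that b b' unfolding settled_def by blast
    then show ?thesis using d'[OF that(1)] by (auto simp: improves_def)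
  qed
  have "\<exists>u<n. p' v = p0 u \<and> enat (d0 u) + dist u v \<le> enat (d' v)" if v: "v < n" for v
  proof (cases "improves d b v")
    case True
    obtain u where u: "u < n" "p b = p0 u" "enat (d0 u) + dist u b \<le> enat (d b)"
      using inv b unfolding settled_def by blast
    have "dist u v \<le> dist u b + dist b v" by (rule distance_triangle)
    also have "\<dots> \<le> dist u b + enat (w {b, v})"
      using True v b by (intro add_left_mono distance_edge) (auto simp: improves_def)
    finally have "enat (d0 u) + dist u v \<le> (enat (d0 u) + dist u b) + enat (w {b, v})"
      by (simp add: add.assoc add_left_mono)
    also have "\<dots> \<le> enat (d b) + enat (w {b, v})" by (intro add_right_mono u)
    finally show ?thesis using u True d'[OF v] p'[OF v] by auto
  next
    case False
    then show ?thesis using inv v d'[OF v] p'[OF v] unfolding settled_def by auto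
  qed
  moreover have "d' v \<le> d' u + w {u, v}" if "u < n" "v < n" "S' u" "{u, v} \<in> E" for u v
  proof (cases "u = b")
    case True
    then show ?thesis using d'[of v] that db by (auto simp: improves_def)
  next
    case False
    then have "S u" using S' that by auto
    then show ?thesis using that inv same[of u] le[of v] unfolding settled_def
      by (metis order_trans)
  qed
  moreover have "d' u \<le> d' v" if "u < n" "v < n" "S' u" "\<not> S' v" for u v
  proof -
    have "d' u \<le> d b" "d' u \<le> d v"
      using that S' inv same b b' db unfolding settled_def by metis+
    then show ?thesis using d'[of v] that by auto
  qed
  moreover have "d' v \<le> d0 v" if "v < n" for v
    using inv le that unfolding settled_def by (meson order_trans)
  ultimately show ?thesis unfolding settled_def by blast
qed

lemma settled_all_closed:
  "settled_all d0 p0 d p \<Longrightarrow> u < n \<Longrightarrow> v < n \<Longrightarrow> {u, v} \<in> E \<Longrightarrow> d v \<le> d u + w {u, v}"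
  unfolding settled_def by blast

lemma settled_all_le: "settled_all d0 p0 d p \<Longrightarrow> v < n \<Longrightarrow> d v \<le> d0 v"
  unfolding settled_def by blast

lemma settled_allE:
  assumes "settled_all d0 p0 d p" "v < n"
  obtains u where "u < n" "p v = p0 u" "enat (d0 u) + dist u v \<le> enat (d v)"
  using assms unfolding settled_def by blast

end

section \<open>Dijkstra's algorithm with selection by linear search\<close>

abbreviation matrix :: "string \<Rightarrow> aexp \<Rightarrow> aexp \<Rightarrow> aexp" where
  "matrix x i j \<equiv> Read x (Add (Read ''r'' i) j)"

definition "relax = For ''v'' (Scalar ''n'')
  (If (And (Less (Const 0) (matrix ''E'' (Scalar ''b'') (Scalar ''v'')))
        (Less (Add (Read ''d'' (Scalar ''b'')) (matrix ''w'' (Scalar ''b'') (Scalar ''v'')))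
          (Read ''d'' (Scalar ''v''))))
    (Seq (Write ''d'' (Scalar ''v'')
           (Add (Read ''d'' (Scalar ''b'')) (matrix ''w'' (Scalar ''b'') (Scalar ''v''))))
         (Write ''p'' (Scalar ''v'') (Read ''p'' (Scalar ''b''))))
    Skip)"

text \<open>The value \<open>n\<close> in \<open>b\<close> means that no unsettled vertex has been
  found yet. The nested negations express a disjunction, which \<open>bexp\<close> lacks; reading
  \<open>d\<close> at address \<open>n\<close> is harmless.\<close>

definition "select = Seq (assign ''b'' (Scalar ''n'')) (For ''v'' (Scalar ''n'')
  (If (And (Less (Read ''f'' (Scalar ''v'')) (Const 1))
        (Not (And (Less (Scalar ''b'') (Scalar ''n''))
          (Not (Less (Read ''d'' (Scalar ''v'')) (Read ''d'' (Scalar ''b'')))))))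
    (assign ''b'' (Scalar ''v'')) Skip))"

text \<open>There is no source vertex: the labels present in \<open>d\<close> and \<open>p\<close>
  are the start values. Thus the same code serves for one source, for many sources and for the
  layers of the dynamic program.\<close>

definition "settle = Seq (For ''v'' (Scalar ''n'') (Write ''f'' (Scalar ''v'') (Const 0)))
  (For ''i'' (Scalar ''n'') (Seq select
    (If (Less (Scalar ''b'') (Scalar ''n''))
      (Seq (Write ''f'' (Scalar ''b'') (Const 1)) relax) Skip)))"

lemmas run_simps = run_Skip run_Write run_Seq run_If

lemma writes_relax [simp]: "writes relax = {''v'', ''d'', ''p''}"
  by (auto simp: relax_def)

lemma writes_select [simp]: "writes select = {''v'', ''b''}"
  by (auto simp: select_def)

lemma writes_settle [simp]: "writes settle = {''v'', ''d'', ''p'', ''b'', ''f'', ''i''}"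
  by (auto simp: settle_def)

context graph
begin

lemma run_relax:
  assumes s: "stored s" "s ''b'' 0 = b" "b < n"
  shows "run relax s (\<lambda>t s'. t \<le> n * 90 \<and>
    (\<forall>v<n. s' ''d'' v = (if improves (s ''d'') b v then s ''d'' b + w {b, v} else s ''d'' v)) \<and>
    (\<forall>v<n. s' ''p'' v = (if improves (s ''d'') b v then s ''p'' b else s ''p'' v)))"
  unfolding relax_def
proof (rule run_For[where N = n and T = 60 and I = "\<lambda>i s'.
    (\<forall>v<n. s' ''d'' v =
      (if v < i \<and> improves (s ''d'') b v then s ''d'' b + w {b, v} else s ''d'' v)) \<and>
    (\<forall>v<n. s' ''p'' v = (if v < i \<and> improves (s ''d'') b v then s ''p'' b else s ''p'' v))"],
    goal_cases)
  case (6 i s')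
  have st: "stored s'" by (rule stored_frame[OF s(1)]) (simp_all add: 6(4))
  \<comment> \<open>\<open>E\<close> has no loops, so \<open>d b\<close> and \<open>p b\<close> keep
    their initial values throughout the scan.\<close>
  have nb: "\<not> improves (s ''d'') b b" using edge_neq by (auto simp: improves_def)
  have eq: "s' ''n'' 0 = n" "s' ''v'' 0 = i" "s' ''b'' 0 = b" "s' ''r'' b = b * n"
      "0 < s' ''E'' (b * n + i) \<longleftrightarrow> {b, i} \<in> E"
      "s' ''w'' (b * n + i) = (if b = i then 0 else w {b, i})"
    using st s 6(1,3,4) by (simp_all add: stored_def)
  have dp: "s' ''d'' b = s ''d'' b" "s' ''d'' i = s ''d'' i" "s' ''p'' b = s ''p'' b"
    using 6(1,2) nb s(3) by simp_all
  have bv: "0 < s' ''E'' (b * n + i) \<and> s ''d'' b + s' ''w'' (b * n + i) < s ''d'' i \<longleftrightarrow>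
      improves (s ''d'') b i"
    using edge_neq[of b i] by (auto simp: eq improves_def)
  have w: "improves (s ''d'') b i \<Longrightarrow> s' ''w'' (b * n + i) = w {b, i}"
    using edge_neq[of b i] by (auto simp: eq improves_def)
  show ?case
  proof (cases "improves (s ''d'') b i")
    case True
    then show ?thesis using 6(2) bv w by (simp add: run_simps eq(1-4) dp less_Suc_eq)
  next
    case False
    then show ?thesis using 6(2) bv by (auto simp: run_simps eq(1-4) dp less_Suc_eq)
  qed
qed (use s n in \<open>auto simp: stored_def\<close>)

lemma run_select:
  assumes s: "stored s"
  shows "run select s (\<lambda>t s'. t \<le> n * 70 \<and> s' ''b'' 0 \<le> n \<and>
    (s' ''b'' 0 = n \<longrightarrow> (\<forall>v<n. s ''f'' v \<noteq> 0)) \<and>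
    (s' ''b'' 0 < n \<longrightarrow> s ''f'' (s' ''b'' 0) = 0 \<and>
      (\<forall>v<n. s ''f'' v = 0 \<longrightarrow> s ''d'' (s' ''b'' 0) \<le> s ''d'' v)))"
  unfolding select_def run_Seq run_Write
proof (rule run_For[where N = n and T = 35 and I = "\<lambda>i s'. s' ''b'' 0 \<le> n \<and>
    (s' ''b'' 0 = n \<longrightarrow> (\<forall>v<i. s ''f'' v \<noteq> 0)) \<and>
    (s' ''b'' 0 < n \<longrightarrow> s ''f'' (s' ''b'' 0) = 0 \<and>
      (\<forall>v<i. s ''f'' v = 0 \<longrightarrow> s ''d'' (s' ''b'' 0) \<le> s ''d'' v))"],
    goal_cases)
  case (6 i s')
  have eq: "s' ''n'' 0 = n" "s' ''d'' = s ''d''" "s' ''f'' = s ''f''"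
    using 6(4) s by (auto simp: stored_def)
  show ?case
  proof (cases "s ''f'' i = 0 \<and> (s' ''b'' 0 < n \<longrightarrow> s ''d'' i < s ''d'' (s' ''b'' 0))")
    case True
    have "\<forall>v<Suc i. s ''f'' v = 0 \<longrightarrow> s ''d'' i \<le> s ''d'' v"
    proof (cases "s' ''b'' 0 = n")
      case True
      then show ?thesis using 6(2) by (auto simp: less_Suc_eq)
    next
      case False
      then show ?thesis using 6(2) True by (fastforce simp: less_Suc_eq)
    qed
    then show ?thesis using True 6(1,3) by (simp add: run_simps eq)
  next
    case False
    then show ?thesis using 6(2,3) by (auto simp: run_simps eq less_Suc_eq)
  qed
qed (use s n in \<open>auto simp: stored_def\<close>)

lemma run_settle:
  assumes s: "stored s"
  shows "run settle s (\<lambda>t s'. t \<le> 300 * (n * n) \<and> settled_all (s ''d'') (s ''p'') (s' ''d'') (s' ''p''))"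
  unfolding settle_def run_Seq run_Write
proof (rule run_For[where N = n and T = 5 and I = "\<lambda>i s'. \<forall>v<i. s' ''f'' v = 0"], goal_cases)
  case (7 t s1)
  have st1: "stored s1" by (rule stored_frame[OF s]) (simp_all add: 7(3))
  have eq1: "s1 ''d'' = s ''d''" "s1 ''p'' = s ''p''" using 7(3) by auto
  show ?case
  \<comment> \<open>The invariant bounds the number of unflagged vertices, which drops in each round
    until it is 0; \<open>n\<close> rounds therefore settle every vertex.\<close>
  proof (rule run_For[where N = n and T = "n * 190" and I = "\<lambda>i s'.
      settled (\<lambda>v. s' ''f'' v \<noteq> 0) (s ''d'') (s ''p'') (s' ''d'') (s' ''p'') \<and>
      card {v. v < n \<and> s' ''f'' v = 0} \<le> n - i"],
      goal_cases)
    case 5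
    have "settled (\<lambda>v. s1 ''f'' v \<noteq> 0) (s ''d'') (s ''p'') (s ''d'') (s ''p'')"
      using settled_init[of "s ''d''" "s ''p''"] 7(2) by (auto simp: settled_def)
    moreover have "card {v. v < n \<and> s1 ''f'' v = 0} \<le> card {..<n}"
      by (intro card_mono) auto
    ultimately show ?case by (simp add: eq1)
  next
    case (6 i s2)
    have st2: "stored s2" by (rule stored_frame[OF st1]) (simp_all add: 6(4))
    show ?case unfolding run_Seq
    proof (rule run_frame[OF run_select[OF st2]], goal_cases)
      case (1 t s3)
      let ?b = "s3 ''b'' 0"
      have eq3: "s3 ''d'' = s2 ''d''" "s3 ''p'' = s2 ''p''" "s3 ''f'' = s2 ''f''"
        "s3 ''n'' 0 = n"
        using 1(2) st2 by (auto simp: stored_def)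
      have st3: "stored s3" by (rule stored_frame[OF st2]) (simp_all add: 1(2))
      show ?case
      proof (cases "?b < n")
        case False
        then have "\<forall>v<n. s2 ''f'' v \<noteq> 0" using 1(1) by auto
        then have "{v. v < n \<and> s2 ''f'' v = 0} = {}" by auto
        then have "card {v. v < n \<and> s2 ''f'' v = 0} \<le> n - Suc i" by (simp only: card.empty)
        then show ?thesis using False 1(1) 6(2) n by (simp add: run_simps eq3)
      next
        case True
        let ?s = "s3(''f'' := (s3 ''f'')(?b := 1))"
        have st: "stored ?s" using st3 by (simp add: stored_def)
        have f: "s2 ''f'' ?b = 0" "\<forall>v<n. s2 ''f'' v = 0 \<longrightarrow> s2 ''d'' ?b \<le> s2 ''d'' v"
          using 1(1) True by auto
        have *: "bval (Less (Scalar ''b'') (Scalar ''n'')) s3" using True eq3 by simp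
        show ?thesis
          unfolding run_If if_P[OF *] run_Seq run_Write aval.simps
        proof (rule run_frame[OF run_relax[of ?s ?b]], goal_cases)
          case (4 t' s4)
          have fs4: "s4 ''f'' = (s2 ''f'')(?b := 1)" using 4(2) eq3 by auto
          have "settled (\<lambda>v. s4 ''f'' v \<noteq> 0) (s ''d'') (s ''p'') (s4 ''d'') (s4 ''p'')"
          proof (rule settled_step)
            show "settled (\<lambda>v. s2 ''f'' v \<noteq> 0) (s ''d'') (s ''p'') (s2 ''d'') (s2 ''p'')"
              using 6(2) by simp
          qed (use 4 True f fs4 eq3 in auto)
          moreover have "card {v. v < n \<and> s4 ''f'' v = 0} \<le> n - Suc i"
          proof -
            have "{v. v < n \<and> s4 ''f'' v = 0} = {v. v < n \<and> s2 ''f'' v = 0} - {?b}"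
              by (auto simp: fs4)
            moreover have "card {v. v < n \<and> s2 ''f'' v = 0} \<le> n - i" using 6(2) by simp
            ultimately show ?thesis using f True by simp
          qed
          moreover have "t \<le> n * 70" "t' \<le> n * 90" using 1(1) 4(1) by auto
          ultimately show ?case using n by auto
        qed (use st True eq3 in auto)
      qed
    qed
  next
    case (7 t' s')
    then have "card {v. v < n \<and> s' ''f'' v = 0} = 0" by simp
    then have "settled_all (s ''d'') (s ''p'') (s' ''d'') (s' ''p'')"
      using 7(2) by (auto simp: settled_def)
    moreover have "1 + t + t' \<le> 300 * (n * n)"
    proof -
      have "t \<le> 35 * n" "t' \<le> 190 * (n * n) + 30 * n"
        using 7(1) \<open>t \<le> _\<close> by (simp_all add: algebra_simps)
      moreover have "n \<le> n * n" "1 \<le> n" using n by auto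
      ultimately show ?thesis by linarith
    qed
    ultimately show ?case by simp
  qed (use st1 n in \<open>auto simp: stored_def\<close>)
qed (use s n in \<open>auto simp: stored_def run_simps less_Suc_eq\<close>)

end

section \<open>Farthest-first traversal\<close>

context graph
begin

text \<open>\<open>M\<close> exceeds the weight of every simple path and plays the role of infinity.\<close>

definition center_inv :: "nat \<Rightarrow> nat \<Rightarrow> (nat \<Rightarrow> nat) \<Rightarrow> (nat \<Rightarrow> nat) \<Rightarrow> bool" where
  "center_inv M l c d \<longleftrightarrow> (\<forall>j<l. c j < n) \<and> (\<forall>v<n. d v \<le> M) \<and>
     (\<forall>v<n. \<forall>j<l. enat (d v) \<le> dist (c j) v) \<and>
     (\<forall>v<n. d v = M \<or> (\<exists>j<l. dist (c j) v \<le> enat (d v))) \<and>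
     (\<forall>j<l. \<forall>i<j. \<forall>v<n. enat (d v) \<le> dist (c i) (c j))"

lemma center_inv_0: "(\<And>v. v < n \<Longrightarrow> d v = M) \<Longrightarrow> center_inv M 0 c d"
  by (simp add: center_inv_def)

text \<open>Earlier centers still carry label 0, so closing \<open>d(g := 0)\<close> gives the
  capped distance to the enlarged set of centers without a restart. Separation holds because labels
  only decrease and \<open>g\<close> has the largest one: every label is at most \<open>d g\<close>,
  which is at most the distance from \<open>g\<close> to each older center.\<close>

lemma center_inv_Suc:
  assumes inv: "center_inv M l c d" and g: "g < n" "\<And>v. v < n \<Longrightarrow> d v \<le> d g"
    and settled: "settled_all (d(g := 0)) p0 d' p"
  shows "center_inv M (Suc l) (c(l := g)) d'"
proof -
  have c: "\<And>j. j < l \<Longrightarrow> c j < n" and dM: "\<And>v. v < n \<Longrightarrow> d v \<le> M"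
    and le: "\<And>v j. v < n \<Longrightarrow> j < l \<Longrightarrow> enat (d v) \<le> dist (c j) v"
    and ge: "\<And>v. v < n \<Longrightarrow> d v = M \<or> (\<exists>j<l. dist (c j) v \<le> enat (d v))"
    and sep: "\<And>i j v. j < l \<Longrightarrow> i < j \<Longrightarrow> v < n \<Longrightarrow> enat (d v) \<le> dist (c i) (c j)"
    using inv unfolding center_inv_def by blast+
  have d': "d' v \<le> (d(g := 0)) v" if "v < n" for v using settled_all_le[OF settled that] .
  then have d'd: "d' v \<le> d v" if "v < n" for v using that by (metis fun_upd_apply le0 le_trans)
  have d0: "d' x = 0" if "x < n" "d x = 0 \<or> x = g" for x
    using d'[OF that(1)] that(2) by (auto split: if_splits)
  have le': "enat (d' v) \<le> dist x v" if "x < n" "d' x = 0" for x v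
  proof -
    have "enat (d' v) \<le> enat (d' x) + dist x v"
      by (rule potential_le_distance) (use settled_all_closed[OF settled] in auto)
    then show ?thesis using that by (simp flip: zero_enat_def)
  qed
  have dc: "d' (c j) = 0" if "j < l" for j
    using le[OF c[OF that] that] c[OF that] d0 by (simp add: distance_self zero_enat_def)
  have 1: "\<forall>v<n. \<forall>j<Suc l. enat (d' v) \<le> dist ((c(l := g)) j) v"
    using le' c dc d0 g(1) by (simp add: less_Suc_eq)
  have 2: "d' v = M \<or> (\<exists>j<Suc l. dist ((c(l := g)) j) v \<le> enat (d' v))" if v: "v < n" for v
  proof -
    obtain u where u: "u < n" "enat ((d(g := 0)) u) + dist u v \<le> enat (d' v)"
      using settled_allE[OF settled v] by blast
    consider "u = g" | "u \<noteq> g" "d u = M" | j where "u \<noteq> g" "j < l" "dist (c j) u \<le> enat (d u)"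
      using ge[OF u(1)] by blast
    then show ?thesis
    proof cases
      case 1
      then show ?thesis using u(2) by (intro disjI2 exI[of _ l]) (simp flip: zero_enat_def)
    next
      case 2
      then have "enat M \<le> enat (d' v)" using u(2) by (metis fun_upd_apply le_iff_add order_trans)
      then show ?thesis using d'd[OF v] dM[OF v] by simp
    next
      case 3
      have "dist (c j) v \<le> dist (c j) u + dist u v" by (rule distance_triangle)
      also have "\<dots> \<le> enat (d u) + dist u v" by (intro add_right_mono 3)
      also have "\<dots> \<le> enat (d' v)" using u(2) 3 by simp
      finally show ?thesis using 3 by (intro disjI2 exI[of _ j]) simp
    qed
  qed
  have 3: "enat (d' v) \<le> dist ((c(l := g)) i) ((c(l := g)) j)"
    if "j < Suc l" "i < j" "v < n" for i j v
  proof (cases "j = l")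
    case True
    have "enat (d' v) \<le> enat (d g)" using d'd[OF that(3)] g(2)[OF that(3)] by simp
    also have "\<dots> \<le> dist (c i) g" using le[OF g(1), of i] that(2) True by simp
    finally show ?thesis using True that by simp
  next
    case False
    have "enat (d' v) \<le> enat (d v)" using d'd[OF that(3)] by simp
    also have "\<dots> \<le> dist (c i) (c j)" using sep[of j i v] that False by simp
    finally show ?thesis using False that by simp
  qed
  show ?thesis unfolding center_inv_def
  proof (intro conjI allI impI)
    fix j assume "j < Suc l" then show "(c(l := g)) j < n" using c g(1) by (cases "j = l") auto
  next
    fix v assume "v < n" then show "d' v \<le> M" using d'd dM by (meson order_trans)
  qed (use 1 2 3 in blast)+
qed

text \<open>A vertex \<open>v\<close> farther than \<open>r\<close> from all centers has a label
  above \<open>r\<close>, since each label is the cap or is realised by a center. No label exceeds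
  the distance between two centers, so these are also pairwise farther than \<open>r\<close> apart,
  and together with \<open>v\<close> they form a packing of \<open>k + 2\<close> vertices.\<close>

lemma centers_cover:
  assumes inv: "center_inv M (Suc k) c d" and M: "r < M" and v: "v < n"
    and packing: "\<And>U. packing {..<n} E w r U \<Longrightarrow> card U \<le> Suc k"
  shows "\<exists>j\<le>k. dist (c j) v \<le> enat r"
proof (rule ccontr)
  assume "\<not> ?thesis"
  then have far: "enat r < dist (c j) v" if "j < Suc k" for j
    using that by (auto simp: less_Suc_eq_le)
  have far': "enat r < dist v (c j)" if "j < Suc k" for j
    using far[OF that] by (subst distance_sym)
  have c: "c j < n" if "j < Suc k" for j using inv that unfolding center_inv_def by blast
  have "r < d v"
    using inv v M far unfolding center_inv_def
    by (metis enat_ord_simps(2) order_less_le_trans)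
  then have sep: "enat r < dist (c i) (c j)" if "j < Suc k" "i < j" for i j
    using inv v that unfolding center_inv_def by (metis enat_ord_simps(2) order_less_le_trans)
  have sep': "enat r < dist (c i) (c j)" if "i < Suc k" "j < Suc k" "i \<noteq> j" for i j
    using sep[of j i] sep[of i j] that by (metis distance_sym linorder_neqE_nat)
  have "inj_on c {..<Suc k}"
  proof (rule inj_onI, rule ccontr)
    fix i j assume "i \<in> {..<Suc k}" "j \<in> {..<Suc k}" "c i = c j" "i \<noteq> j"
    then show False using sep'[of i j] c[of j] by (simp add: distance_self)
  qed
  moreover have "v \<notin> c ` {..<Suc k}"
  proof
    assume "v \<in> c ` {..<Suc k}"
    then obtain j where "j < Suc k" "v = c j" by auto
    then show False using far[of j] v by (simp add: distance_self)
  qed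
  ultimately have "card (insert v (c ` {..<Suc k})) = Suc (Suc k)"
    by (simp add: card_image)
  moreover have "packing {..<n} E w r (insert v (c ` {..<Suc k}))"
    unfolding packing_def
  proof (intro conjI ballI impI)
    show "insert v (c ` {..<Suc k}) \<subseteq> {..<n}" using c v by auto
    fix a b assume "a \<in> insert v (c ` {..<Suc k})" "b \<in> insert v (c ` {..<Suc k})" "a \<noteq> b"
    then show "enat r < dist a b"
      using far far' sep' by (elim insertE imageE) auto
  qed
  ultimately show False using packing by fastforce
qed

end

section \<open>The traversal as a program\<close>

definition "reset = For ''v'' (Scalar ''n'') (Write ''d'' (Scalar ''v'') (Scalar ''I''))"

definition "farthest = Seq (assign ''g'' (Const 0)) (For ''v'' (Scalar ''n'')
  (If (Less (Read ''d'' (Scalar ''g'')) (Read ''d'' (Scalar ''v'')))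
    (assign ''g'' (Scalar ''v'')) Skip))"

definition "centers = Seq reset (For ''l'' (Add (Scalar ''K'') (Const 1))
  (Seq farthest (Seq (Write ''C'' (Scalar ''l'') (Scalar ''g''))
    (Seq (Write ''d'' (Scalar ''g'') (Const 0)) settle))))"

lemma writes_reset [simp]: "writes reset = {''v'', ''d''}"
  by (auto simp: reset_def)

lemma writes_farthest [simp]: "writes farthest = {''v'', ''g''}"
  by (auto simp: farthest_def)

lemma writes_centers [simp]:
  "writes centers = {''l'', ''C'', ''g'', ''v'', ''d'', ''p'', ''b'', ''f'', ''i''}"
  by (auto simp: centers_def)

context graph
begin

lemma run_reset:
  assumes "stored s"
  shows "run reset s (\<lambda>t s'. t \<le> n * 40 \<and> (\<forall>v<n. s' ''d'' v = s ''I'' 0))"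
  unfolding reset_def
proof (rule run_For[where N = n and T = 10 and I = "\<lambda>i s'. \<forall>v<i. s' ''d'' v = s ''I'' 0"], goal_cases)
  case (6 i s')
  then show ?case by (simp add: run_simps less_Suc_eq)
qed (use assms n in \<open>auto simp: stored_def\<close>)

lemma run_farthest:
  assumes "stored s"
  shows "run farthest s (\<lambda>t s'. t \<le> n * 60 \<and> s' ''g'' 0 < n \<and>
    (\<forall>v<n. s ''d'' v \<le> s ''d'' (s' ''g'' 0)))"
  unfolding farthest_def run_Seq run_Write
proof (rule run_For[where N = n and T = 20 and I = "\<lambda>i s'. s' ''g'' 0 < n \<and>
    (\<forall>v<i. s ''d'' v \<le> s ''d'' (s' ''g'' 0))"], goal_cases)
  case (6 i s')
  have d: "s' ''d'' = s ''d''" by (simp add: 6(4))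
  show ?case
  proof (cases "s ''d'' (s' ''g'' 0) < s ''d'' i")
    case True
    then have "\<forall>v<i. s ''d'' v \<le> s ''d'' i" using 6(2) by (meson le_trans less_imp_le)
    then show ?thesis using True 6(1,3) by (simp add: run_simps d less_Suc_eq)
  next
    case False
    then show ?thesis using 6(2,3) by (auto simp: run_simps d less_Suc_eq)
  qed
qed (use assms n in \<open>auto simp: stored_def\<close>)

lemma run_centers:
  assumes s: "stored s" "s ''K'' 0 = k"
  shows "run centers s (\<lambda>t s'. t \<le> Suc k * (500 * (n * n)) \<and>
    center_inv (s ''I'' 0) (Suc k) (s' ''C'') (s' ''d''))"
  unfolding centers_def run_Seq
proof (rule run_frame[OF run_reset[OF s(1)]], goal_cases)
  case (1 t s1)
  have nn: "n \<le> n * n" "1 \<le> n" using n by auto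
  have st1: "stored s1" by (rule stored_frame[OF s(1)]) (simp_all add: 1(2))
  have K1: "s1 ''K'' 0 = k" using s by (simp add: 1(2))
  show ?case
  proof (rule run_For[where N = "Suc k" and T = "400 * (n * n)" and
      I = "\<lambda>l s'. center_inv (s ''I'' 0) l (s' ''C'') (s' ''d'')"], goal_cases)
    case 5
    show ?case using 1(1) by (intro center_inv_0) simp
  next
    case (6 l s2)
    have st2: "stored s2" by (rule stored_frame[OF st1]) (simp_all add: 6(4))
    show ?case unfolding run_Seq run_Write aval.simps
    proof (rule run_frame[OF run_farthest[OF st2]], goal_cases)
      case (1 t s3)
      have st3: "stored s3" by (rule stored_frame[OF st2]) (simp_all add: 1(2))
      let ?g = "s3 ''g'' 0"
      let ?s = "let s' = s3(''C'' := (s3 ''C'')(s3 ''l'' 0 := ?g))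
        in s'(''d'' := (s' ''d'')(s' ''g'' 0 := 0))"
      have st: "stored ?s" by (rule stored_frame[OF st3]) simp_all
      show ?case
      proof (rule run_frame[OF run_settle[OF st, unfolded Let_def]], goal_cases)
        case (1 t' s4)
        have eq: "s3 ''l'' 0 = l" "s3 ''d'' = s2 ''d''" "s3 ''C'' = s2 ''C''"
          using 6(3) by (simp_all add: \<open>\<And>x. x \<notin> writes farthest \<Longrightarrow> s3 x = s2 x\<close>)
        have C: "s4 ''C'' = (s2 ''C'')(l := ?g)" by (simp add: 1(2) eq)
        have "center_inv (s ''I'' 0) (Suc l) (s4 ''C'') (s4 ''d'')"
          unfolding C
        proof (rule center_inv_Suc[OF 6(2)])
          show "settled_all ((s2 ''d'')(?g := 0)) (s3 ''p'') (s4 ''d'') (s4 ''p'')"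
            using 1(1) by (simp add: eq)
        qed (use \<open>t \<le> n * 60 \<and> _\<close> in auto)
        moreover have "t \<le> n * 60" "t' \<le> 300 * (n * n)" using 1(1) \<open>t \<le> n * 60 \<and> _\<close> by auto
        moreover from this have "12 + t + t' \<le> 400 * (n * n)" using nn by linarith
        ultimately show ?case by simp
      qed
    qed
  next
    case (7 t' s')
    have "t \<le> 40 * n" using 1(1) by simp
    moreover have "t' \<le> Suc k * (400 * (n * n) + 30)" using 7(1) by simp
    moreover have "Suc k * (400 * (n * n) + 30) + Suc k * (70 * (n * n)) \<le> Suc k * (500 * (n * n))"
      unfolding add_mult_distrib2[symmetric] using nn by (intro mult_le_mono) auto
    moreover have "70 * (n * n) \<le> Suc k * (70 * (n * n))" by simp
    ultimately have "1 + t + t' \<le> Suc k * (500 * (n * n))" using nn by linarith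
    then show ?case using 7(2) by simp
  qed (use K1 in \<open>auto\<close>)
qed

end

section \<open>Paths with a bounded number of non-edges\<close>

context graph
begin

text \<open>The Bellman equation for crossing at most one non-edge into \<open>v\<close>. All
  non-edges of the graph are candidates, since no optimal set is known. Endpoints of a non-edge
  differ, so \<open>q v = v\<close> is free to encode that none is crossed.\<close>

definition entry :: "(nat \<Rightarrow> nat) \<Rightarrow> (nat \<Rightarrow> nat) \<Rightarrow> (nat \<Rightarrow> nat) \<Rightarrow> nat \<Rightarrow> bool" where
  "entry d e q v \<longleftrightarrow> e v \<le> d v \<and> (\<forall>u<n. u \<noteq> v \<longrightarrow> {u, v} \<notin> E \<longrightarrow> e v \<le> d u + w {u, v}) \<and>
     q v < n \<and> (if q v = v then e v = d v else {q v, v} \<notin> E \<and> e v = d (q v) + w {q v, v})"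

definition layer :: "(nat \<Rightarrow> nat) \<Rightarrow> (nat \<Rightarrow> nat) \<Rightarrow> (nat \<Rightarrow> nat) \<Rightarrow> (nat \<Rightarrow> nat) \<Rightarrow> bool" where
  "layer d q p d' \<longleftrightarrow> (\<exists>e. (\<forall>v<n. entry d e q v) \<and> settled_all e (\<lambda>v. v) d' p)"

text \<open>\<open>f j v\<close> is the least weight of a walk to \<open>v\<close> with at most \<open>j\<close> non-edges, capped by \<open>M\<close>.
  The last part inside \<open>G\<close> of a walk attaining \<open>f (Suc i) v\<close> starts at \<open>b = L (i * n + v)\<close>; it is
  preceded by the non-edge from \<open>Q (i * n + b)\<close> to \<open>b\<close>, or \<open>Q (i * n + b) = b\<close> if there is none.\<close>

definition layering :: "nat \<Rightarrow> nat \<Rightarrow> nat \<Rightarrow> (nat \<Rightarrow> nat) \<Rightarrow> (nat \<Rightarrow> nat) \<Rightarrow> (nat \<Rightarrow> nat \<Rightarrow> nat) \<Rightarrow> bool"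
  where
  "layering M a k Q L f \<longleftrightarrow>
     (\<exists>p0 p. settled_all (\<lambda>v. if v = a then 0 else M) p0 (f 0) p) \<and>
     (\<forall>i<k. layer (f i) (\<lambda>v. Q (i * n + v)) (\<lambda>v. L (i * n + v)) (f (Suc i)))"

lemma settled_all_cong:
  assumes "settled_all d0 p0 d p" "\<And>v. v < n \<Longrightarrow> d0 v = d0' v" "\<And>v. v < n \<Longrightarrow> p0 v = p0' v"
    "\<And>v. v < n \<Longrightarrow> p v = p' v"
  shows "settled_all d0' p0' d p'"
  unfolding settled_def
proof (intro conjI allI impI)
  fix v assume v: "v < n"
  show "d v \<le> d0' v" using settled_all_le[OF assms(1) v] assms(2) v by simp
  obtain u where "u < n" "p v = p0 u" "enat (d0 u) + dist u v \<le> enat (d v)"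
    using settled_allE[OF assms(1) v] .
  then show "\<exists>u<n. p' v = p0' u \<and> enat (d0' u) + dist u v \<le> enat (d v)"
    using assms(2-4) v by (intro exI[of _ u]) auto
qed (use settled_all_closed[OF assms(1)] in auto)

lemma entry_cong: "e v = e' v \<Longrightarrow> q v = q' v \<Longrightarrow> entry d e q v \<longleftrightarrow> entry d e' q' v"
  by (simp add: entry_def)

lemma layer_cong:
  assumes "layer d q p d'" "\<And>v. v < n \<Longrightarrow> q v = q' v" "\<And>v. v < n \<Longrightarrow> p v = p' v"
  shows "layer d q' p' d'"
proof -
  obtain e where e: "\<forall>v<n. entry d e q v" "settled_all e (\<lambda>v. v) d' p"
    using assms(1) unfolding layer_def by blast
  have "\<forall>v<n. entry d e q' v" using e(1) assms(2) entry_cong by metis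
  moreover have "settled_all e (\<lambda>v. v) d' p'"
    by (rule settled_all_cong[OF e(2)]) (use assms(3) in auto)
  ultimately show ?thesis unfolding layer_def by blast
qed

text \<open>The layers minimise over all non-edges, so their values lie below the weight of every
  path with few enough non-edges, whichever set \<open>F\<close> these come from.\<close>

lemma layering_le_path_weight:
  assumes f: "layering M a k Q L f" and a: "a < n"
    and F: "F \<subseteq> [{..<n}]\<^bsup>2\<^esup>" and p: "is_path {..<n} (E \<union> F) a p v"
    and k: "length (filter (\<lambda>e. e \<notin> E) (path_edges p)) \<le> k"
  shows "f k v \<le> path_weight w p"
proof -
  have lay: "\<exists>e. (\<forall>v<n. entry (f j) e (\<lambda>v. Q (j * n + v)) v) \<and>
      settled_all e (\<lambda>v. v) (f (Suc j)) (\<lambda>v. L (j * n + v))" if "j < k" for j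
    using f that unfolding layering_def layer_def by blast
  have closed: "f j y \<le> f j x + w {x, y}" if "j \<le> k" "x < n" "y < n" "{x, y} \<in> E" for j x y
  proof (cases j)
    case 0
    then show ?thesis using f settled_all_closed that unfolding layering_def by blast
  next
    case (Suc i)
    then show ?thesis using lay[of i] settled_all_closed that by (meson Suc_le_eq)
  qed
  have step: "f (Suc j) y \<le> f j y"
    "x < n \<Longrightarrow> x \<noteq> y \<Longrightarrow> {x, y} \<notin> E \<Longrightarrow> f (Suc j) y \<le> f j x + w {x, y}"
    if jy: "j < k" "y < n" for j x y
  proof -
    obtain e where e: "entry (f j) e (\<lambda>v. Q (j * n + v)) y" "f (Suc j) y \<le> e y"
      using lay[OF jy(1)] settled_all_le jy(2) by meson
    from e(1) have 1: "e y \<le> f j y" "\<forall>u<n. u \<noteq> y \<longrightarrow> {u, y} \<notin> E \<longrightarrow> e y \<le> f j u + w {u, y}"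
      unfolding entry_def by blast+
    from 1(1) e(2) show "f (Suc j) y \<le> f j y" by (rule order_trans[rotated])
    assume "x < n" "x \<noteq> y" "{x, y} \<notin> E"
    with 1(2) have "e y \<le> f j x + w {x, y}" by blast
    with e(2) show "f (Suc j) y \<le> f j x + w {x, y}" by (rule order_trans)
  qed
  have neq: "x \<noteq> y" if "{x, y} \<in> F" for x y using F that by (auto simp: nsets_def)
  have "f k v \<le> f 0 a + path_weight w p"
    by (rule layered_potential_le_path_weight[of k "{..<n}" f E w F a p v])
      (use closed step neq p k in auto)
  moreover have "f 0 a \<le> 0"
    using f settled_all_le[of _ _ "f 0" _ a] a unfolding layering_def by fastforce
  ultimately show ?thesis by simp
qed

end

section \<open>The dynamic program as a program\<close>

definition "enter_edges = For ''u'' (Scalar ''n'')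
    (If (And (Less (matrix ''E'' (Scalar ''u'') (Scalar ''v'')) (Const 1))
          (Less (Add (Read ''d'' (Scalar ''u'')) (matrix ''w'' (Scalar ''u'') (Scalar ''v'')))
            (Read ''e'' (Scalar ''v''))))
      (Seq (Write ''e'' (Scalar ''v'')
             (Add (Read ''d'' (Scalar ''u'')) (matrix ''w'' (Scalar ''u'') (Scalar ''v''))))
           (Write ''Q'' (Add (Read ''r'' (Scalar ''j'')) (Scalar ''v'')) (Scalar ''u'')))
      Skip)"

text \<open>New labels go to a separate array \<open>e\<close>: overwriting \<open>d\<close> during
  the scan could let two non-edges count as one layer. Starting from \<open>p v = v\<close> makes
  the labels left by \<open>settle\<close> name the vertex at which the last part inside the graph
  begins.\<close>

definition "enter = For ''v'' (Scalar ''n'')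
  (Seq (Write ''e'' (Scalar ''v'') (Read ''d'' (Scalar ''v'')))
  (Seq (Write ''p'' (Scalar ''v'') (Scalar ''v''))
  (Seq (Write ''Q'' (Add (Read ''r'' (Scalar ''j'')) (Scalar ''v'')) (Scalar ''v''))
  enter_edges)))"

definition "next_layer = Seq enter
  (Seq (For ''v'' (Scalar ''n'') (Write ''d'' (Scalar ''v'') (Read ''e'' (Scalar ''v''))))
  (Seq settle
  (For ''v'' (Scalar ''n'')
    (Write ''L'' (Add (Read ''r'' (Scalar ''j'')) (Scalar ''v'')) (Read ''p'' (Scalar ''v''))))))"

lemma writes_enter_edges [simp]: "writes enter_edges = {''u'', ''e'', ''Q''}"
  by (auto simp: enter_edges_def)

lemma writes_enter [simp]: "writes enter = {''v'', ''e'', ''p'', ''Q'', ''u''}"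
  by (auto simp: enter_def)

lemma writes_next_layer [simp]:
  "writes next_layer = {''v'', ''e'', ''p'', ''Q'', ''u'', ''d'', ''b'', ''f'', ''i'', ''L''}"
  by (auto simp: next_layer_def)

context graph
begin

lemma run_enter:
  assumes s: "stored s" "s ''j'' 0 = j" "j < n"
  shows "run enter s (\<lambda>t s'. t \<le> 180 * (n * n) \<and>
    (\<forall>v<n. entry (s ''d'') (s' ''e'') (\<lambda>v. s' ''Q'' (j * n + v)) v) \<and>
    (\<forall>v<n. s' ''p'' v = v) \<and> (\<forall>a<j * n. s' ''Q'' a = s ''Q'' a))"
  unfolding enter_def
proof (rule run_For[where N = n and T = "n * 120 + 30" and I = "\<lambda>i s'.
    (\<forall>v<i. entry (s ''d'') (s' ''e'') (\<lambda>v. s' ''Q'' (j * n + v)) v) \<and>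
    (\<forall>v<i. s' ''p'' v = v) \<and> (\<forall>a<j * n. s' ''Q'' a = s ''Q'' a)"], goal_cases)
  case (6 v s1)
  have st1: "stored s1" by (rule stored_frame[OF s(1)]) (simp_all add: 6(4))
  have eq1: "s1 ''d'' = s ''d''" "s1 ''j'' 0 = j" "s1 ''v'' 0 = v" "s1 ''r'' j = j * n"
    using st1 s 6(3) by (simp_all add: 6(4) stored_def)
  let ?s = "let s' = s1(''e'' := (s1 ''e'')(v := s ''d'' v));
    s' = s'(''p'' := (s' ''p'')(v := v)) in s'(''Q'' := (s' ''Q'')(j * n + v := v))"
  define s2 where "s2 = ?s"
  have st2: "stored s2" by (rule stored_frame[OF st1]) (simp_all add: s2_def)
  have eq2: "s2 ''e'' = (s1 ''e'')(v := s ''d'' v)" "s2 ''p'' = (s1 ''p'')(v := v)"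
    "s2 ''Q'' = (s1 ''Q'')(j * n + v := v)" "s2 ''d'' = s ''d''" "s2 ''j'' 0 = j" "s2 ''v'' 0 = v"
    by (simp_all add: s2_def eq1)
  have inner: "run enter_edges s2 (\<lambda>t s'. t \<le> n * 120 \<and>
        entry (s ''d'') (s' ''e'') (\<lambda>v. s' ''Q'' (j * n + v)) v \<and>
        (\<forall>x. x \<noteq> v \<longrightarrow> s' ''e'' x = s2 ''e'' x) \<and>
        (\<forall>x. x \<noteq> j * n + v \<longrightarrow> s' ''Q'' x = s2 ''Q'' x) \<and> s' ''p'' = s2 ''p'')"
    unfolding enter_edges_def
  proof (rule run_For[where N = n and T = 80 and I = "\<lambda>i s'. s' ''e'' v \<le> s ''d'' v \<and>
      (\<forall>u<i. u \<noteq> v \<longrightarrow> {u, v} \<notin> E \<longrightarrow> s' ''e'' v \<le> s ''d'' u + w {u, v}) \<and>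
      s' ''Q'' (j * n + v) < n \<and>
      (s' ''Q'' (j * n + v) = v \<longrightarrow> s' ''e'' v = s ''d'' v) \<and>
      (s' ''Q'' (j * n + v) \<noteq> v \<longrightarrow> {s' ''Q'' (j * n + v), v} \<notin> E \<and>
         s' ''e'' v = s ''d'' (s' ''Q'' (j * n + v)) + w {s' ''Q'' (j * n + v), v}) \<and>
        (\<forall>x. x \<noteq> v \<longrightarrow> s' ''e'' x = s2 ''e'' x) \<and>
        (\<forall>x. x \<noteq> j * n + v \<longrightarrow> s' ''Q'' x = s2 ''Q'' x)"], goal_cases)
    case 5
    then show ?case using 6(1) by (simp add: eq2)
  next
    case (6 u s3)
    have st3: "stored s3" by (rule stored_frame[OF st2]) (simp_all add: 6(4))
    have eq3: "s3 ''d'' = s ''d''" "s3 ''j'' 0 = j" "s3 ''v'' 0 = v" "s3 ''u'' 0 = u"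
        "s3 ''r'' j = j * n" "s3 ''r'' u = u * n"
      using st3 s(3) 6(1,3) eq2 by (simp_all add: 6(4) stored_def)
    have E3: "0 < s3 ''E'' (u * n + v) \<longleftrightarrow> {u, v} \<in> E"
      using st3 6(1) \<open>v < n\<close> by (simp add: stored_def)
    then have E3': "s3 ''E'' (u * n + v) = 0 \<longleftrightarrow> {u, v} \<notin> E" by auto
    have w3: "s3 ''w'' (u * n + v) = (if u = v then 0 else w {u, v})"
      using st3 6(1) \<open>v < n\<close> by (simp add: stored_def)
    show ?case
    proof (cases "{u, v} \<notin> E \<and> s ''d'' u + s3 ''w'' (u * n + v) < s3 ''e'' v")
      case True
      \<comment> \<open>The diagonal passes the non-edge test, as \<open>E\<close> has no loops.
        Only the strict comparison rejects it: its weight cell is 0 and \<open>e v\<close> never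
        exceeds \<open>d v\<close>.\<close>
      have "u \<noteq> v"
      proof
        assume "u = v"
        then have "s ''d'' v < s3 ''e'' v" using True w3 by simp
        then show False using 6(2) by simp
      qed
      then have w3': "s3 ''w'' (u * n + v) = w {u, v}" using w3 by simp
      have "\<forall>u'<Suc u. u' \<noteq> v \<longrightarrow> {u', v} \<notin> E \<longrightarrow> s ''d'' u + w {u, v} \<le> s ''d'' u' + w {u', v}"
        using 6(2) True unfolding w3' by (auto simp: less_Suc_eq intro: order_trans[OF less_imp_le])
      moreover have "s ''d'' u + w {u, v} \<le> s ''d'' v" using 6(2) True unfolding w3' by simp
      ultimately show ?thesis using 6(1,2) True \<open>u \<noteq> v\<close> unfolding w3'
        by (simp add: run_simps eq3 E3 E3' w3')
    next
      case False
      have "\<forall>u'<Suc u. u' \<noteq> v \<longrightarrow> {u', v} \<notin> E \<longrightarrow> s3 ''e'' v \<le> s ''d'' u' + w {u', v}"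
        using 6(2) False w3 by (auto simp: less_Suc_eq)
      then show ?thesis using 6(2)
        by (simp add: run_simps eq3 E3 E3' False split del: if_split)
    qed
  next
    case (7 t s')
    then show ?case by (simp add: entry_def)
  qed (use st2 n in \<open>auto simp: stored_def\<close>)
  have entries: "entry (s ''d'') (s4 ''e'') (\<lambda>v. s4 ''Q'' (j * n + v)) x"
    if "x < v" "\<forall>x. x \<noteq> v \<longrightarrow> s4 ''e'' x = s2 ''e'' x"
      "\<forall>x. x \<noteq> j * n + v \<longrightarrow> s4 ''Q'' x = s2 ''Q'' x" for s4 :: store and x
  proof -
    have "entry (s ''d'') (s1 ''e'') (\<lambda>v. s1 ''Q'' (j * n + v)) x" using 6(2) that(1) by blast
    then show ?thesis
      by (subst entry_cong[where e' = "s1 ''e''" and q' = "\<lambda>v. s1 ''Q'' (j * n + v)"])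
        (use that in \<open>auto simp: eq2\<close>)
  qed
  show ?case
    unfolding run_Seq run_Write
  proof (rule run_mono'[OF inner], goal_cases)
    case 1
    show ?case by (simp add: s2_def eq1)
  next
    case (2 t s4)
    then have "s4 ''p'' x = x" if "x < Suc v" for x
      using 6(2) that by (auto simp: eq2 less_Suc_eq)
    moreover have "\<forall>a<j * n. s4 ''Q'' a = s ''Q'' a" using 2 6(2) by (simp add: eq2)
    moreover have "entry (s ''d'') (s4 ''e'') (\<lambda>v. s4 ''Q'' (j * n + v)) x" if "x < Suc v" for x
      using 2 entries[of x s4] that by (auto simp: less_Suc_eq)
    ultimately show ?case using 2 by simp
  qed
next
  case (7 t s')
  have "t \<le> 120 * (n * n) + 60 * n" using 7(1) by (simp add: algebra_simps)
  moreover have "n \<le> n * n" using n by simp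
  ultimately have "t \<le> 180 * (n * n)" by linarith
  then show ?case using 7(2) by simp
qed (use s n in \<open>auto simp: stored_def\<close>)

lemma run_next_layer:
  assumes s: "stored s" "s ''j'' 0 = j" "j < n"
  shows "run next_layer s (\<lambda>t s'. t \<le> 600 * (n * n) \<and>
    layer (s ''d'') (\<lambda>v. s' ''Q'' (j * n + v)) (\<lambda>v. s' ''L'' (j * n + v)) (s' ''d'') \<and>
    (\<forall>a<j * n. s' ''Q'' a = s ''Q'' a \<and> s' ''L'' a = s ''L'' a))"
  unfolding next_layer_def run_Seq
proof (rule run_frame[OF run_enter[OF s]], goal_cases)
  case (1 t1 s1)
  have st1: "stored s1" by (rule stored_frame[OF s(1)]) (simp_all add: 1(2))
  note post1 = 1(1) and frame1 = 1(2)
  show ?case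
  proof (rule run_For[where N = n and T = 10 and I = "\<lambda>i s'. \<forall>v<i. s' ''d'' v = s1 ''e'' v"], goal_cases)
    case (6 i s')
    have "s' ''e'' = s1 ''e''" by (simp add: 6(4))
    then show ?case using 6(1-3) by (simp add: run_simps less_Suc_eq)
  next
    case (7 t2 s2)
    have st2: "stored s2" by (rule stored_frame[OF st1]) (simp_all add: 7(3))
    note post2 = 7(1,2) and frame2 = 7(3)
    show ?case
    proof (rule run_frame[OF run_settle[OF st2]], goal_cases)
      case (1 t3 s3)
      have st3: "stored s3" by (rule stored_frame[OF st2]) (simp_all add: 1(2))
      note post3 = 1(1) and frame3 = 1(2)
      have j3: "s3 ''j'' 0 = j" using s by (simp add: frame1 frame2 frame3)
      show ?case
      proof (rule run_For[where N = n and T = 15 and I = "\<lambda>i s'.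
          (\<forall>v<i. s' ''L'' (j * n + v) = s3 ''p'' v) \<and> (\<forall>a<j * n. s' ''L'' a = s3 ''L'' a)"],
          goal_cases)
        case (6 i s')
        have "s' ''p'' = s3 ''p''" "s' ''j'' 0 = j" "s' ''r'' j = j * n"
          using j3 st3 s(3) by (simp_all add: 6(4) stored_def)
        then show ?case using 6(1-3) by (simp add: run_simps less_Suc_eq)
      next
        case (7 t4 s4)
        have Q: "s4 ''Q'' = s1 ''Q''" "s4 ''d'' = s3 ''d''"
          by (simp_all add: 7(3) frame2 frame3)
        have "s2 ''p'' v = v" if "v < n" for v using post1 that by (simp add: frame2)
        then have "settled_all (s1 ''e'') (\<lambda>v. v) (s3 ''d'') (\<lambda>v. s4 ''L'' (j * n + v))"
          using post2(2) 7(2) by - (rule settled_all_cong[OF conjunct2[OF post3]], auto)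
        then have "layer (s ''d'') (\<lambda>v. s4 ''Q'' (j * n + v)) (\<lambda>v. s4 ''L'' (j * n + v)) (s4 ''d'')"
          unfolding layer_def Q using post1 by blast
        moreover have "\<forall>a<j * n. s4 ''Q'' a = s ''Q'' a \<and> s4 ''L'' a = s ''L'' a"
          using post1 7(2) by (simp add: Q frame1 frame2 frame3)
        moreover have "3 + t1 + t2 + t3 + t4 \<le> 600 * (n * n)"
        proof -
          have "t1 \<le> 180 * (n * n)" "t2 \<le> 40 * n" "t3 \<le> 300 * (n * n)" "t4 \<le> 45 * n"
            using post1 post2 post3 7(1) by auto
          moreover have "n \<le> n * n" "1 \<le> n" using n by auto
          ultimately show ?thesis by linarith
        qed
        ultimately show ?case by simp
      qed (use st3 n in \<open>simp_all add: stored_def\<close>)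
    qed
  qed (use st1 n in \<open>simp_all add: stored_def\<close>)
qed

end

text \<open>The array \<open>d\<close> is overwritten from layer to layer. The traceback reads only
  the rows of \<open>Q\<close> and \<open>L\<close>, so the values \<open>f j\<close> survive merely
  as a witness in the proof.\<close>

definition "layers = Seq reset (Seq (Write ''d'' (Read ''C'' (Const 0)) (Const 0))
  (Seq settle (For ''j'' (Scalar ''K'') next_layer)))"

lemma writes_layers [simp]:
  "writes layers = {''v'', ''e'', ''p'', ''Q'', ''u'', ''d'', ''b'', ''f'', ''i'', ''L'', ''j''}"
  by (auto simp: layers_def)

context graph
begin

lemma run_layers:
  assumes s: "stored s" "s ''K'' 0 = k" "1 \<le> k" "k \<le> n"
  shows "run layers s (\<lambda>t s'. t \<le> k * (1100 * (n * n)) \<and>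
    (\<exists>f. layering (s ''I'' 0) (s ''C'' 0) k (s' ''Q'') (s' ''L'') f))"
  unfolding layers_def run_Seq run_Write
proof (rule run_frame[OF run_reset[OF s(1)]], goal_cases)
  case (1 t1 s1)
  have st1: "stored s1" by (rule stored_frame[OF s(1)]) (simp_all add: 1(2))
  note post1 = 1(1) and frame1 = 1(2)
  let ?s = "s1(''d'' := (s1 ''d'')(aval (Read ''C'' (Const 0)) s1 := aval (Const 0) s1))"
  have st: "stored ?s" by (rule stored_frame[OF st1]) simp_all
  show ?case
  proof (rule run_frame[OF run_settle[OF st]], goal_cases)
    case (1 t2 s2)
    have st2: "stored s2" by (rule stored_frame[OF st]) (simp_all add: 1(2))
    note post2 = 1(1) and frame2 = 1(2)
    have K2: "s2 ''K'' 0 = k" using s by (simp add: frame1 frame2)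
    have base: "settled_all (\<lambda>v. if v = s ''C'' 0 then 0 else s ''I'' 0) (?s ''p'') (s2 ''d'') (s2 ''p'')"
    proof (rule settled_all_cong)
      show "settled_all (?s ''d'') (?s ''p'') (s2 ''d'') (s2 ''p'')" using post2 by blast
    qed (use post1 in \<open>auto simp: frame1\<close>)
    show ?case
    proof (rule run_For[where N = k and T = "600 * (n * n)" and I = "\<lambda>i s'. \<exists>f.
        layering (s ''I'' 0) (s ''C'' 0) i (s' ''Q'') (s' ''L'') f \<and> f i = s' ''d''"], goal_cases)
      case 5
      show ?case using base by (intro exI[of _ "\<lambda>_. s2 ''d''"]) (auto simp: layering_def)
    next
      case (6 j s3)
      have st3: "stored s3" by (rule stored_frame[OF st2]) (simp_all add: 6(4))
      obtain f where f: "layering (s ''I'' 0) (s ''C'' 0) j (s3 ''Q'') (s3 ''L'') f" "f j = s3 ''d''"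
        using 6(2) by blast
      \<comment> \<open>The row table is known up to index \<open>n\<close> only; capping the budget
        at \<open>n\<close> also keeps the layer numbers within it.\<close>
      have jn: "j < n" using 6(1) s(4) by simp
      show ?case
      proof (rule run_mono[OF run_next_layer[OF st3 6(3) jn]], goal_cases)
        case (1 t s4)
        let ?f = "f(Suc j := s4 ''d'')"
        have "layer (?f i) (\<lambda>v. s4 ''Q'' (i * n + v)) (\<lambda>v. s4 ''L'' (i * n + v)) (?f (Suc i))"
          if i: "i < Suc j" for i
        proof (cases "i = j")
          case True
          then show ?thesis using 1 f(2) by simp
        next
          case False
          \<comment> \<open>Hence writing row \<open>j\<close> leaves the records of all earlier
            layers intact.\<close>
          have "i * n + v < j * n" if "v < n" for v
          proof -
            have "i * n + v < Suc i * n" using that by simp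
            also have "\<dots> \<le> j * n" using False i by (intro mult_le_mono1) simp
            finally show ?thesis .
          qed
          then have "layer (f i) (\<lambda>v. s4 ''Q'' (i * n + v)) (\<lambda>v. s4 ''L'' (i * n + v)) (f (Suc i))"
            using f(1) False i 1
            by - (rule layer_cong[of "f i" "\<lambda>v. s3 ''Q'' (i * n + v)" "\<lambda>v. s3 ''L'' (i * n + v)"],
              auto simp: layering_def)
          then show ?thesis using False i by simp
        qed
        then have "layering (s ''I'' 0) (s ''C'' 0) (Suc j) (s4 ''Q'') (s4 ''L'') ?f"
          using f(1) by (simp add: layering_def)
        then show ?case using 1 by auto
      qed
    next
      case (7 t3 s3)
      have "t1 \<le> 40 * n" "t2 \<le> 300 * (n * n)" using post1 post2 by auto
      moreover have "n \<le> n * n" "1 \<le> n" using n by auto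
      moreover have "t3 \<le> k * (600 * (n * n) + 30)" by (rule 7(1))
      moreover have "k * (600 * (n * n) + 30) + k * (400 * (n * n)) \<le> k * (1100 * (n * n))"
        unfolding add_mult_distrib2[symmetric]
        by (rule mult_le_mono2) (use \<open>n \<le> n * n\<close> \<open>1 \<le> n\<close> in linarith)
      moreover have "400 * (n * n) \<le> k * (400 * (n * n))" using s(3) by simp
      ultimately have "10 + t1 + t2 + t3 \<le> k * (1100 * (n * n))" by linarith
      then show ?case using 7(2) by auto
    qed (use K2 s in auto)
  qed
qed

end

section \<open>Recovering the added non-edges from the stored labels\<close>

definition "emit = Seq (Write ''x'' (Scalar ''m'') (Scalar ''a''))
  (Seq (Write ''y'' (Scalar ''m'') (Scalar ''u''))
    (assign ''m'' (Add (Scalar ''m'') (Const 1))))"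

text \<open>Layers are visited downwards, round \<open>j\<close> reading row
  \<open>K - (j + 1)\<close>. Two negated comparisons test equality of \<open>u\<close> and
  \<open>a\<close>, the case in which the layer contributes no pair.\<close>

definition "step_back =
  Seq (assign ''h'' (Read ''r'' (Sub (Scalar ''K'') (Add (Scalar ''j'') (Const 1)))))
  (Seq (assign ''a'' (Read ''L'' (Add (Scalar ''h'') (Scalar ''g''))))
  (Seq (assign ''u'' (Read ''Q'' (Add (Scalar ''h'') (Scalar ''a''))))
  (Seq (If (And (Not (Less (Scalar ''u'') (Scalar ''a''))) (Not (Less (Scalar ''a'') (Scalar ''u''))))
      Skip emit)
    (assign ''g'' (Scalar ''u'')))))"

definition "traceback = For ''l'' (Scalar ''K'')
  (Seq (assign ''g'' (Read ''C'' (Add (Scalar ''l'') (Const 1))))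
    (For ''j'' (Scalar ''K'') step_back))"

lemma writes_step_back [simp]: "writes step_back = {''h'', ''a'', ''u'', ''g'', ''x'', ''y'', ''m''}"
  by (auto simp: step_back_def emit_def)

lemma output_set_fun_upd [simp]:
  "x \<notin> {''x'', ''y'', ''m''} \<Longrightarrow> output_set (s(x := a)) = output_set s"
proof -
  assume "x \<notin> {''x'', ''y'', ''m''}"
  then have "(s(x := a)) z = s z" if "z \<in> {''x'', ''y'', ''m''}" for z using that by auto
  then show ?thesis by (simp only: output_set_def insert_iff simp_thms)
qed

lemma output_set_snoc:
  assumes "s' ''x'' = (s ''x'')(s ''m'' 0 := a)" "s' ''y'' = (s ''y'')(s ''m'' 0 := u)"
    "s' ''m'' 0 = Suc (s ''m'' 0)"
  shows "output_set s' = insert {a, u} (output_set s)"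
  using assms by (auto simp: output_set_def less_Suc_eq; metis nat_neq_iff)

lemma writes_emit [simp]: "writes emit = {''x'', ''y'', ''m''}"
  by (auto simp: emit_def)

lemma run_emit:
  "run emit s (\<lambda>t s'. t \<le> 20 \<and> s' ''m'' 0 = Suc (s ''m'' 0) \<and>
     output_set s' = insert {s ''a'' 0, s ''u'' 0} (output_set s))"
proof -
  let ?s = "s(''x'' := (s ''x'')(s ''m'' 0 := s ''a'' 0), ''y'' := (s ''y'')(s ''m'' 0 := s ''u'' 0),
    ''m'' := (s ''m'')(0 := Suc (s ''m'' 0)))"
  have "output_set ?s = insert {s ''a'' 0, s ''u'' 0} (output_set s)"
    by (rule output_set_snoc) simp_all
  then show ?thesis by (simp add: emit_def run_simps)
qed

text \<open>The same pair may be emitted for several centers, so the counter bounds the number of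
  added edges from above only, which is the direction that the budget asks for.\<close>

lemma card_output_set: "finite (output_set s)" "card (output_set s) \<le> s ''m'' 0"
proof -
  have "output_set s = (\<lambda>r. {s ''x'' r, s ''y'' r}) ` {..<s ''m'' 0}"
    by (auto simp: output_set_def)
  then show "finite (output_set s)" "card (output_set s) \<le> s ''m'' 0"
    using card_image_le[of "{..<s ''m'' 0}"] by simp_all
qed

context graph
begin

abbreviation dist_with :: "nat set set \<Rightarrow> nat \<Rightarrow> nat \<Rightarrow> enat" where
  "dist_with F \<equiv> distance {..<n} (E \<union> F) w"

text \<open>The distance to the target \<open>c\<close> already secured by the output, plus the
  label of the current vertex, never increases: a step back trades part of the label for a stretch
  inside the graph and at most one emitted non-edge. Enlarging the output only shortens
  distances.\<close>

lemma layer_step_back: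
  assumes lay: "layer d q p d'" and g: "g < n" "dist_with F g c + enat (d' g) \<le> t"
    and F': "F \<subseteq> F'" "q (p g) \<noteq> p g \<Longrightarrow> {p g, q (p g)} \<in> F'"
  shows "p g < n" "q (p g) < n" "q (p g) \<noteq> p g \<Longrightarrow> {p g, q (p g)} \<in> [{..<n}]\<^bsup>2\<^esup> - E"
    "dist_with F' (q (p g)) c + enat (d (q (p g))) \<le> t"
proof -
  let ?a = "p g" and ?u = "q (p g)"
  obtain e where e: "\<And>v. v < n \<Longrightarrow> entry d e q v" "settled_all e (\<lambda>v. v) d' p"
    using lay unfolding layer_def by blast
  have a: "?a < n" "enat (e ?a) + dist ?a g \<le> enat (d' g)"
    using settled_allE[OF e(2) g(1)] by metis+
  have u: "?u < n" "?u = ?a \<Longrightarrow> e ?a = d ?a"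
      "?u \<noteq> ?a \<Longrightarrow> {?u, ?a} \<notin> E" "?u \<noteq> ?a \<Longrightarrow> e ?a = d ?u + w {?u, ?a}"
    using e(1)[OF a(1)] unfolding entry_def by (auto split: if_splits)
  show "?a < n" "?u < n" by fact+
  show "{?a, ?u} \<in> [{..<n}]\<^bsup>2\<^esup> - E" if "?u \<noteq> ?a"
    using a(1) u(1,3) that by (auto simp: nsets_def insert_commute)
  have "enat (d ?u) + dist_with F' ?u ?a \<le> enat (e ?a)"
  proof (cases "?u = ?a")
    case True
    then show ?thesis using u(2) a(1) by (simp add: distance_self)
  next
    case False
    then have "{?u, ?a} \<in> E \<union> F'" using F'(2) by (simp add: insert_commute)
    then have "dist_with F' ?u ?a \<le> enat (w {?u, ?a})"
      using a(1) u(1) by (intro distance_edge) auto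
    then have "enat (d ?u) + dist_with F' ?u ?a \<le> enat (d ?u) + enat (w {?u, ?a})"
      by (rule add_left_mono)
    then show ?thesis using u(4)[OF False] by simp
  qed
  moreover have "dist_with F' ?a g \<le> dist ?a g" "dist_with F' g c \<le> dist_with F g c"
    using F'(1) by (intro distance_mono; blast)+
  moreover have "dist_with F' ?u c \<le> dist_with F' ?u ?a + (dist_with F' ?a g + dist_with F' g c)"
    by (rule order_trans[OF distance_triangle add_left_mono[OF distance_triangle]])
  ultimately have "dist_with F' ?u c + enat (d ?u) \<le>
      (enat (e ?a) + dist ?a g) + dist_with F g c"
  proof -
    have "dist_with F' ?u c + enat (d ?u) \<le>
        (enat (d ?u) + dist_with F' ?u ?a) + dist_with F' ?a g + dist_with F' g c"
      using add_right_mono[OF \<open>dist_with F' ?u c \<le> _\<close>, of "enat (d ?u)"] by (simp add: ac_simps)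
    also have "\<dots> \<le> enat (e ?a) + dist ?a g + dist_with F g c"
      by (intro add_mono) fact+
    finally show ?thesis .
  qed
  also have "\<dots> \<le> enat (d' g) + dist_with F g c" by (intro add_right_mono a(2))
  also have "\<dots> \<le> t" using g(2) by (simp add: add.commute)
  finally show "dist_with F' ?u c + enat (d ?u) \<le> t" .
qed

lemma run_step_back:
  assumes s: "stored s" "s ''K'' 0 = k" "k \<le> n" "s ''j'' 0 = j" "j < k" "s ''g'' 0 = g" "g < n"
    and f: "layering M a0 k (s ''Q'') (s ''L'') f"
    and out: "output_set s \<subseteq> [{..<n}]\<^bsup>2\<^esup> - E"
    and le: "dist_with (output_set s) g c + enat (f (k - j) g) \<le> t0"
  shows "run step_back s (\<lambda>t s'. t \<le> 80 \<and> s' ''g'' 0 < n \<and>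
    output_set s \<subseteq> output_set s' \<and> output_set s' \<subseteq> [{..<n}]\<^bsup>2\<^esup> - E \<and>
    s' ''m'' 0 \<le> Suc (s ''m'' 0) \<and>
    dist_with (output_set s') (s' ''g'' 0) c + enat (f (k - Suc j) (s' ''g'' 0)) \<le> t0)"
proof -
  define i where "i = k - Suc j"
  have i: "i < k" "Suc i = k - j" "i < n" "i \<le> n" using s(3,5) by (auto simp: i_def)
  define q where "q = (\<lambda>v. s ''Q'' (i * n + v))"
  define p where "p = (\<lambda>v. s ''L'' (i * n + v))"
  have lay: "layer (f i) q p (f (Suc i))"
    using f i(1) by (auto simp: layering_def q_def p_def)
  note step = layer_step_back[OF lay s(7), of "output_set s" c t0, unfolded i, OF le]
  have r: "s ''r'' i = i * n" using s(1) i(4) by (simp add: stored_def)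
  have pq: "s ''L'' (i * n + g) = p g" "s ''Q'' (i * n + p g) = q (p g)"
    by (simp_all add: p_def q_def)
  show ?thesis
  proof (cases "q (p g) = p g")
    case True
    have *: "p g < n" "dist_with (output_set s) (p g) c + enat (f i (p g)) \<le> t0"
      using step[of "output_set s"] True by auto
    show ?thesis using * True out
      by (simp add: step_back_def run_simps s(2,4,6) r pq flip: i_def)
  next
    case False
    let ?F = "insert {p g, q (p g)} (output_set s)"
    have *: "q (p g) < n" "{p g, q (p g)} \<in> [{..<n}]\<^bsup>2\<^esup> - E"
        "dist_with ?F (q (p g)) c + enat (f i (q (p g))) \<le> t0"
      using step[of ?F] False by auto
    have neq: "(\<not> q (p g) < p g \<and> \<not> p g < q (p g)) = False" using False by auto
    show ?thesis
      apply (simp add: step_back_def run_simps s(2,4,6) r pq neq flip: i_def)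
      apply (rule run_frame[OF run_emit])
    proof goal_cases
      case (1 t s')
      have "output_set s' = ?F" using 1(1) by simp
      moreover have "s' ''u'' 0 = q (p g)" by (simp add: 1(2))
      ultimately show ?case using 1(1) * out by auto
    qed
  qed
qed

text \<open>The alternative \<open>M \<le> f k _\<close> covers a label whose walk begins at a
  capped vertex instead of at the first center; \<open>approximation\<close> later excludes it. The
  pairs emitted in that case are still non-edges and still counted.\<close>

lemma run_traceback:
  assumes s: "stored s" "s ''K'' 0 = k" "1 \<le> k" "k \<le> n" "s ''m'' 0 = 0"
    and f: "layering M (s ''C'' 0) k (s ''Q'') (s ''L'') f"
    and c: "\<And>i. i \<le> k \<Longrightarrow> s ''C'' i < n"
  shows "run traceback s (\<lambda>t s'. t \<le> k * (200 * (n * n)) \<and>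
    output_set s' \<subseteq> [{..<n}]\<^bsup>2\<^esup> - E \<and> card (output_set s') \<le> k * k \<and>
    (\<forall>i<k. M \<le> f k (s ''C'' (Suc i)) \<or>
      dist_with (output_set s') (s ''C'' 0) (s ''C'' (Suc i)) \<le> enat (f k (s ''C'' (Suc i)))))"
  unfolding traceback_def
proof (rule run_For[where N = k and T = "150 * n" and I = "\<lambda>l s'.
    output_set s' \<subseteq> [{..<n}]\<^bsup>2\<^esup> - E \<and> s' ''m'' 0 \<le> l * k \<and>
    (\<forall>i<l. M \<le> f k (s ''C'' (Suc i)) \<or>
      dist_with (output_set s') (s ''C'' 0) (s ''C'' (Suc i)) \<le> enat (f k (s ''C'' (Suc i))))"],
    goal_cases)
  case 5
  show ?case using s(5) by (simp add: output_set_def)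
next
  case (6 l s1)
  have st1: "stored s1" by (rule stored_frame[OF s(1)]) (simp_all add: 6(4))
  have eq1: "s1 ''C'' = s ''C''" "s1 ''K'' 0 = k" "s1 ''Q'' = s ''Q''" "s1 ''L'' = s ''L''"
    using s(2) by (simp_all add: 6(4))
  let ?c = "s ''C'' (Suc l)"
  note IH = 6(2)
  have cn: "?c < n" using c 6(1) by simp
  show ?case unfolding run_Seq run_Write
  proof (rule run_For[where N = k and T = 80 and I = "\<lambda>j s'.
      output_set s1 \<subseteq> output_set s' \<and> output_set s' \<subseteq> [{..<n}]\<^bsup>2\<^esup> - E \<and>
      s' ''m'' 0 \<le> l * k + j \<and> s' ''g'' 0 < n \<and>
      dist_with (output_set s') (s' ''g'' 0) ?c + enat (f (k - j) (s' ''g'' 0)) \<le> enat (f k ?c)"],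
      goal_cases)
    case 5
    then show ?case using 6(2,3) cn
      by (simp add: eq1 distance_self)
  next
    case (6 j s2)
    have st2: "stored s2" by (rule stored_frame[OF st1]) (simp_all add: 6(4))
    have "run step_back s2 (\<lambda>t s'. t \<le> 80 \<and> s' ''g'' 0 < n \<and>
      output_set s2 \<subseteq> output_set s' \<and> output_set s' \<subseteq> [{..<n}]\<^bsup>2\<^esup> - E \<and>
      s' ''m'' 0 \<le> Suc (s2 ''m'' 0) \<and>
      dist_with (output_set s') (s' ''g'' 0) ?c + enat (f (k - Suc j) (s' ''g'' 0)) \<le> enat (f k ?c))"
    proof (rule run_step_back[OF st2 _ s(4) 6(3,1) refl])
      show "layering M (s ''C'' 0) k (s2 ''Q'') (s2 ''L'') f" using f by (simp add: 6(4) eq1)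
    qed (use 6(2) eq1 in \<open>auto simp: 6(4)\<close>)
    then show ?case
    proof (rule run_mono, goal_cases)
      case (1 t s3)
      then show ?case using 1 6(2) by auto
    qed
  next
    case (7 t s2)
    let ?F = "output_set s2" and ?g = "s2 ''g'' 0"
    have g: "?g < n" "dist_with ?F ?g ?c + enat (f 0 ?g) \<le> enat (f k ?c)"
      and sub: "output_set s1 \<subseteq> ?F"
      using 7(2) by simp_all
    obtain p0 p where f0: "settled_all (\<lambda>v. if v = s ''C'' 0 then 0 else M) p0 (f 0) p"
      using f unfolding layering_def by blast
    \<comment> \<open>At layer 0 the remaining label is realised by a start vertex: the first
      center, which gives the distance bound, or a vertex with start label \<open>M\<close>, which
      forces the final label up to \<open>M\<close>.\<close>
    obtain u where u: "enat (if u = s ''C'' 0 then 0 else M) + dist u ?g \<le> enat (f 0 ?g)"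
      using settled_allE[OF f0 g(1)] by metis
    have new: "M \<le> f k ?c \<or> dist_with ?F (s ''C'' 0) ?c \<le> enat (f k ?c)"
    proof (cases "u = s ''C'' 0")
      case True
      have "dist_with ?F u ?c \<le> dist_with ?F u ?g + dist_with ?F ?g ?c" by (rule distance_triangle)
      also have "\<dots> \<le> enat (f 0 ?g) + dist_with ?F ?g ?c"
        using u True distance_mono[of E "E \<union> ?F" "{..<n}" w u ?g]
        by (intro add_right_mono) (auto simp flip: zero_enat_def)
      also have "\<dots> \<le> enat (f k ?c)" using g(2) by (simp add: add.commute)
      finally show ?thesis using True by simp
    next
      case False
      have "enat M \<le> enat M + dist u ?g" by simp
      also have "\<dots> \<le> enat (f 0 ?g)" using u False by simp
      also have "\<dots> \<le> dist_with ?F ?g ?c + enat (f 0 ?g)" by simp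
      also have "\<dots> \<le> enat (f k ?c)" by (rule g(2))
      finally show ?thesis by simp
    qed
    have old: "M \<le> f k (s ''C'' (Suc i)) \<or>
        dist_with ?F (s ''C'' 0) (s ''C'' (Suc i)) \<le> enat (f k (s ''C'' (Suc i)))" if "i < l" for i
    proof -
      have "dist_with ?F (s ''C'' 0) (s ''C'' (Suc i)) \<le>
          dist_with (output_set s1) (s ''C'' 0) (s ''C'' (Suc i))"
        using sub by (intro distance_mono) blast
      then show ?thesis using IH that by (meson order_trans)
    qed
    have "\<forall>i<Suc l. M \<le> f k (s ''C'' (Suc i)) \<or>
        dist_with ?F (s ''C'' 0) (s ''C'' (Suc i)) \<le> enat (f k (s ''C'' (Suc i)))"
      using new old by (simp add: less_Suc_eq)
    moreover have "10 + t \<le> 150 * n"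
    proof -
      have "t \<le> n * 110" using 7(1) mult_le_mono1[OF s(4), of 110] by simp
      then show ?thesis using n by simp
    qed
    ultimately show ?case using 7(2) by simp
  qed (use st1 s(3) eq1 in auto)
next
  case (7 t s')
  have "t \<le> k * (200 * (n * n))"
  proof -
    have "150 * n + 30 \<le> 200 * (n * n)"
    proof -
      have "n \<le> n * n" "1 \<le> n" using n by auto
      then show ?thesis by linarith
    qed
    then show ?thesis using 7(1) by (meson mult_le_mono2 order_trans)
  qed
  moreover have "card (output_set s') \<le> k * k" using 7(2) card_output_set(2)[of s'] by linarith
  ultimately show ?case using 7(2) by blast
qed (use s in auto)

end

section \<open>The approximation algorithm\<close>

context graph
begin

text \<open>A finite diameter makes every pair joined by a simple path, so it lies below the cap.
  The sum ranges over all pairs because \<open>E'\<close> may contain added non-edges.\<close>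

lemma diameter_le_sum:
  assumes "diameter {..<n} E' w = enat r"
  shows "r \<le> (\<Sum>x<n. \<Sum>y\<in>{..<n} - {x}. w {x, y})" (is "_ \<le> ?S")
proof -
  have "distance {..<n} E' w u v \<le> enat ?S" if "u < n" "v < n" for u v
  proof -
    have "distance {..<n} E' w u v \<le> enat r"
      unfolding assms[symmetric] diameter_def using that
      by (intro SUP_upper2[of u] SUP_upper) auto
    then obtain p where p: "is_path {..<n} E' u p v" by (rule distance_le_enatE)
    have "path_weight w p \<le> ?S" by (rule path_weight_le_sum[OF _ p]) simp
    then show ?thesis by (intro order_trans[OF distance_le_path_weight[OF p]]) simp
  qed
  then have "diameter {..<n} E' w \<le> enat ?S" unfolding diameter_def by (auto intro!: SUP_least)
  then show ?thesis using assms by simp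
qed

text \<open>The alternative \<open>n \<le> k\<close> handles a budget capped at the number of
  vertices. Then \<open>n\<close> instead of \<open>card F\<close> bounds both the size of a packing
  and the number of non-edges on a simple path.\<close>

lemma approximation:
  assumes c: "center_inv M (Suc k) c d" and f: "layering M (c 0) k Q L f"
    and M: "(\<Sum>x<n. \<Sum>y\<in>{..<n} - {x}. w {x, y}) < M"
    and out: "\<And>i. i < k \<Longrightarrow> M \<le> f k (c (Suc i)) \<or>
      dist_with H (c 0) (c (Suc i)) \<le> enat (f k (c (Suc i)))"
    and F: "F \<subseteq> [{..<n}]\<^bsup>2\<^esup>" "card F \<le> k \<or> n \<le> k"
    and r: "diameter {..<n} (E \<union> F) w = enat r"
  shows "diameter {..<n} (E \<union> H) w \<le> enat (4 * r)"
proof -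
  have finF: "finite F" using F(1) by (rule finite_subset) (simp add: finite_imp_finite_nsets)
  have rM: "r < M" using diameter_le_sum[OF r] M by simp
  have cn: "c j < n" if "j \<le> k" for j using c that by (simp add: center_inv_def)
  have cover: "\<exists>j\<le>k. dist (c j) v \<le> enat r" if "v < n" for v
  proof (rule centers_cover[OF c rM that])
    fix U assume U: "packing {..<n} E w r U"
    have "card U \<le> Suc (card F)"
    proof (rule card_packing_le[OF _ finF _ U])
      show "\<exists>x y. e = {x, y}" if "e \<in> F" for e
        using that F(1) unfolding nsets_def card_2_iff by blast
    qed (simp_all add: r)
    moreover have "card U \<le> n"
      using U card_mono[of "{..<n}" U] by (simp add: packing_def)
    ultimately show "card U \<le> Suc k" using F(2) by linarith
  qed
  have f_le: "f k v \<le> r" if "v < n" for v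
  proof -
    have "distance {..<n} (E \<union> F) w (c 0) v \<le> enat r"
      unfolding r[symmetric] diameter_def using that cn[of 0]
      by (intro SUP_upper2[of "c 0"] SUP_upper) auto
    then obtain p where p: "is_path {..<n} (E \<union> F) (c 0) p v" "path_weight w p \<le> r"
      by (rule distance_le_enatE)
    then have dp: "distinct p" "set p \<subseteq> {..<n}" "set (path_edges p) \<subseteq> E \<union> F"
      by (simp_all add: is_path_def)
    \<comment> \<open>A simple path traverses each edge at most once, so its non-edges can be
      counted as a subset of \<open>F\<close>.\<close>
    let ?N = "filter (\<lambda>e. e \<notin> E) (path_edges p)"
    have "length ?N \<le> card F"
    proof -
      have "length ?N = card (set ?N)"
        by (rule distinct_card[symmetric]) (simp add: distinct_path_edges dp)
      also have "\<dots> \<le> card F" using dp(3) by (intro card_mono finF) auto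
      finally show ?thesis .
    qed
    moreover have "length ?N \<le> n"
    proof -
      have "length ?N \<le> length p"
        by (rule order_trans[OF length_filter_le length_path_edges])
      also have "\<dots> = card (set p)" using dp(1) by (simp add: distinct_card)
      also have "\<dots> \<le> n" using card_mono[OF _ dp(2)] by simp
      finally show ?thesis .
    qed
    ultimately have "length ?N \<le> k" using F(2) by linarith
    then have "f k v \<le> path_weight w p"
      using layering_le_path_weight[OF f _ F(1) p(1)] cn[of 0] by simp
    then show ?thesis using p(2) by simp
  qed
  have hub: "dist_with H (c 0) (c j) \<le> enat r" if "j \<le> k" for j
  proof (cases j)
    case 0
    then show ?thesis using cn[of 0] by (simp add: distance_self)
  next
    case (Suc i)
    then have "f k (c j) \<le> r" "i < k" using f_le cn that by auto
    then have "dist_with H (c 0) (c j) \<le> enat (f k (c j))" using out[of i] rM Suc by auto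
    also have "\<dots> \<le> enat r" using \<open>f k (c j) \<le> r\<close> by simp
    finally show ?thesis .
  qed
  have near: "dist_with H (c 0) v \<le> enat (2 * r)" if v: "v < n" for v
  proof -
    obtain j where j: "j \<le> k" "dist (c j) v \<le> enat r" using cover[OF v] by blast
    have "dist_with H (c j) v \<le> enat r"
      using distance_mono[of E "E \<union> H"] j(2) by (meson Un_upper1 order_trans)
    then have "dist_with H (c 0) (c j) + dist_with H (c j) v \<le> enat r + enat r"
      by (intro add_mono hub j)
    then show ?thesis using order_trans[OF distance_triangle] by (simp add: mult_2)
  qed
  have "dist_with H u v \<le> enat (4 * r)" if "u < n" "v < n" for u v
  proof -
    have "dist_with H u (c 0) + dist_with H (c 0) v \<le> enat (2 * r) + enat (2 * r)"
      using near that by (intro add_mono) (simp_all add: distance_sym[of _ _ _ u])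
    then show ?thesis using order_trans[OF distance_triangle] by simp
  qed
  then show ?thesis unfolding diameter_def by (auto intro!: SUP_least)
qed

end

definition "main = Seq centers (Seq layers traceback)"

context graph
begin

text \<open>The competitor \<open>F\<close> is quantified in the postcondition: one and the same
  output is compared with every set of finite diameter. In the time bound \<open>k + 1\<close>
  rounds of the traversal count as at most \<open>2 * k\<close>.\<close>

lemma run_main:
  assumes s: "stored s" "s ''K'' 0 = k" "1 \<le> k" "k \<le> n" "s ''m'' 0 = 0"
    and M: "(\<Sum>x<n. \<Sum>y\<in>{..<n} - {x}. w {x, y}) < s ''I'' 0"
  shows "run main s (\<lambda>t s'. t \<le> 2400 * (k * (n * n)) \<and>
    output_set s' \<subseteq> [{..<n}]\<^bsup>2\<^esup> - E \<and> card (output_set s') \<le> k * k \<and>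
    (\<forall>F r. F \<subseteq> [{..<n}]\<^bsup>2\<^esup> \<longrightarrow> card F \<le> k \<or> n \<le> k \<longrightarrow>
      diameter {..<n} (E \<union> F) w = enat r \<longrightarrow>
      diameter {..<n} (E \<union> output_set s') w \<le> enat (4 * r)))"
  unfolding main_def run_Seq
proof (rule run_frame[OF run_centers[OF s(1,2)]], goal_cases)
  case (1 t1 s1)
  note post1 = 1(1) and frame1 = 1(2)
  have st1: "stored s1" by (rule stored_frame[OF s(1)]) (simp_all add: frame1)
  have eq1: "s1 ''K'' 0 = k" "s1 ''I'' = s ''I''" "s1 ''m'' 0 = 0"
    using s by (simp_all add: frame1)
  show ?case
  proof (rule run_frame[OF run_layers[OF st1 eq1(1) s(3,4)]], goal_cases)
    case (1 t2 s2)
    note post2 = 1(1) and frame2 = 1(2)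
    have st2: "stored s2" by (rule stored_frame[OF st1]) (simp_all add: frame2)
    have eq2: "s2 ''K'' 0 = k" "s2 ''C'' = s1 ''C''" "s2 ''m'' 0 = 0"
      using eq1 by (simp_all add: frame2)
    obtain f where f: "layering (s ''I'' 0) (s2 ''C'' 0) k (s2 ''Q'') (s2 ''L'') f"
      using post2 eq1 eq2 by auto
    have cn: "s2 ''C'' i < n" if "i \<le> k" for i
      using post1 that eq2 by (simp add: center_inv_def)
    show ?case
    proof (rule run_mono[OF run_traceback[OF st2 eq2(1) s(3,4) eq2(3) f cn]], goal_cases)
      case (2 t3 s3)
      have "t1 + t2 + t3 + 2 \<le> 2400 * (k * (n * n))"
      proof -
        have "1 * 1 \<le> k * (n * n)" using s(3) n by (intro mult_le_mono) auto
        moreover have "n * n \<le> k * (n * n)" using s(3) by simp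
        moreover have "t1 \<le> 500 * (k * (n * n)) + 500 * (n * n)" using post1 by (simp add: algebra_simps)
        moreover have "t2 \<le> 1100 * (k * (n * n))" "t3 \<le> 200 * (k * (n * n))"
          using post2 2 by (simp_all add: algebra_simps)
        ultimately show ?thesis by linarith
      qed
      moreover have "diameter {..<n} (E \<union> output_set s3) w \<le> enat (4 * r)"
        if "F \<subseteq> [{..<n}]\<^bsup>2\<^esup>" "card F \<le> k \<or> n \<le> k" "diameter {..<n} (E \<union> F) w = enat r" for F r
        by (rule approximation[where c = "s2 ''C''", OF _ f M _ that]) (use post1 2 eq2 in auto)
      ultimately show ?case using 2 by simp
    qed
  qed
qed

end

section \<open>Preprocessing and the complete program\<close>

definition "capacity = If (Less (Scalar ''B'') (Scalar ''n''))
  (assign ''K'' (Scalar ''B'')) (assign ''K'' (Scalar ''n''))"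

text \<open>Multiples of \<open>n\<close> by repeated addition, relying on the initial 0 in cell 0
  of \<open>r\<close>.\<close>

definition "rows = For ''i'' (Scalar ''n'')
  (Write ''r'' (Add (Scalar ''i'') (Const 1)) (Add (Read ''r'' (Scalar ''i'')) (Scalar ''n'')))"

definition "add_row = For ''v'' (Scalar ''n'')
  (assign ''I'' (Add (Scalar ''I'') (matrix ''w'' (Scalar ''u'') (Scalar ''v''))))"

text \<open>Starting at 1 makes the cap strictly larger than the sum of weights, so that it is
  distinguishable from every finite diameter. The diagonal cells add 0.\<close>

definition "bound = Seq (assign ''I'' (Const 1)) (For ''u'' (Scalar ''n'') add_row)"

definition "program = Seq capacity (If (Less (Const 0) (Scalar ''K''))
  (Seq rows (Seq bound main)) Skip)"

lemma writes_rows [simp]: "writes rows = {''i'', ''r''}"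
  by (auto simp: rows_def)

lemma writes_add_row [simp]: "writes add_row = {''v'', ''I''}"
  by (auto simp: add_row_def)

lemma writes_bound [simp]: "writes bound = {''u'', ''v'', ''I''}"
  by (auto simp: bound_def)

context graph
begin

lemma run_rows:
  assumes "s ''n'' 0 = n" "s ''r'' 0 = 0"
  shows "run rows s (\<lambda>t s'. t \<le> 50 * n \<and> (\<forall>i\<le>n. s' ''r'' i = i * n))"
  unfolding rows_def
proof (rule run_For[where N = n and T = 20 and I = "\<lambda>i s'. \<forall>i'\<le>i. s' ''r'' i' = i' * n"], goal_cases)
  case (6 i s')
  have "s' ''n'' 0 = n" using assms by (simp add: 6(4))
  then show ?case using 6(1-3) by (simp add: run_simps le_Suc_eq)
qed (use assms n in auto)

lemma run_add_row:
  assumes s: "stored s" "s ''u'' 0 = u" "u < n"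
  shows "run add_row s (\<lambda>t s'. t \<le> 60 * n \<and>
    s' ''I'' 0 = s ''I'' 0 + (\<Sum>v\<in>{..<n} - {u}. w {u, v}))"
  unfolding add_row_def
proof (rule run_For[where N = n and T = 30 and I = "\<lambda>i s'.
    s' ''I'' 0 = s ''I'' 0 + (\<Sum>v<i. if u = v then 0 else w {u, v})"], goal_cases)
  case (6 v s')
  have st: "stored s'" by (rule stored_frame[OF s(1)]) (simp_all add: 6(4))
  have "s' ''r'' u = u * n" "s' ''u'' 0 = u"
      "s' ''w'' (u * n + v) = (if u = v then 0 else w {u, v})"
    using st s(2,3) 6(1) by (simp_all add: stored_def) (simp add: 6(4))
  then show ?case using 6(1-3) by (simp add: run_simps)
next
  case (7 t s')
  have "(\<Sum>v<n. if u = v then 0 else w {u, v}) = (\<Sum>v\<in>{..<n} - {u}. w {u, v})"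
    by (rule sum.mono_neutral_cong_right) auto
  then show ?case using 7(1,2) by simp
qed (use s n in \<open>auto simp: stored_def\<close>)

lemma run_bound:
  assumes s: "stored s"
  shows "run bound s (\<lambda>t s'. t \<le> 100 * (n * n) \<and>
    s' ''I'' 0 = Suc (\<Sum>x<n. \<Sum>y\<in>{..<n} - {x}. w {x, y}))"
  unfolding bound_def run_Seq run_Write
proof (rule run_For[where N = n and T = "60 * n" and I = "\<lambda>i s'.
    s' ''I'' 0 = Suc (\<Sum>x<i. \<Sum>y\<in>{..<n} - {x}. w {x, y})"], goal_cases)
  case (6 u s')
  have st: "stored s'" by (rule stored_frame[OF s]) (simp_all add: 6(4))
  show ?case
    by (rule run_mono[OF run_add_row[OF st 6(3,1)]]) (use 6(2) in simp)
next
  case (7 t s')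
  have "t \<le> 60 * (n * n) + 30 * n" using 7(1) by (simp add: algebra_simps)
  moreover have "n \<le> n * n" "1 \<le> n" using n by auto
  ultimately have "t + 4 \<le> 100 * (n * n)" by linarith
  then show ?case using 7(2) by simp
qed (use s n in \<open>auto simp: stored_def\<close>)

end

lemma run_program:
  assumes I: "standard_instance I" "unit_cost I"
  shows "run program (input_store I) (\<lambda>t s.
    (1 \<le> budget I \<longrightarrow> 1 \<le> card (verts I) \<longrightarrow> t \<le> 3000 * (budget I * card (verts I) ^ 2)) \<and>
    approx_solution (budget I) 4 I (output_set s))"
proof -
  define n where "n = card (verts I)"
  define k where "k = min (budget I) n"
  define s0 where "s0 = input_store I"
  have V: "verts I = {..<n}" and E: "edges I \<subseteq> [{..<n}]\<^bsup>2\<^esup>"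
    using I(1) by (auto simp: standard_instance_def bcmd_instance_def n_def)
  have s0: "s0 ''n'' 0 = n" "s0 ''B'' 0 = budget I" "s0 ''r'' a = 0" "s0 ''m'' 0 = 0" for a
    by (simp_all add: s0_def input_store_def Let_def n_def)
  have s0_E: "(0 < s0 ''E'' (i * n + j)) = ({i, j} \<in> edges I)" if "i < n" "j < n" for i j
    using that by (simp add: s0_def input_store_def Let_def flip: n_def)
  have s0_w: "s0 ''w'' (i * n + j) = (if i = j then 0 else weight I {i, j})" if "i < n" "j < n" for i j
    using that by (simp add: s0_def input_store_def Let_def V nsets_def flip: n_def)
  have cost: "(\<Sum>e\<in>F. cost I e) = card F" if "F \<subseteq> [verts I]\<^bsup>2\<^esup>" for F
    using that I(2) by (simp add: unit_cost_def subset_iff)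
  let ?s = "s0(''K'' := (s0 ''K'')(0 := k))"
  have capacity: "run capacity s0 (\<lambda>t s. t \<le> 20 \<and> s = ?s)"
    by (auto simp: capacity_def run_simps s0 k_def min_def)
  have card_le: "card F \<le> budget I" if "feasible I F" for F
  proof -
    have "F \<subseteq> [verts I]\<^bsup>2\<^esup>" using that by (auto simp: feasible_def non_edges_def)
    then show ?thesis using that cost[of F] by (simp add: feasible_def)
  qed
  have fin: "finite F" if "feasible I F" for F
    using that unfolding feasible_def non_edges_def V
    by (auto intro: finite_subset[of F "[{..<n}]\<^bsup>2\<^esup>"] simp: finite_imp_finite_nsets)
  show ?thesis
  proof (cases "k = 0")
    case True
    \<comment> \<open>The cap is 0 if there are no vertices, where every diameter is 0, or if the
      budget is 0, where unit costs leave only the empty set. In both cases the empty output is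
      optimal.\<close>
    have "diameter_with I {} \<le> diameter_with I F" if F: "feasible I F" for F
    proof (cases "n = 0")
      case True
      then show ?thesis by (simp add: diameter_with_def diameter_def V bot_enat_def)
    next
      case False
      then have "budget I = 0" using \<open>k = 0\<close> by (simp add: k_def min_def split: if_splits)
      then have "F = {}" using card_le[OF F] fin[OF F] by simp
      then show ?thesis by simp
    qed
    then have "diameter_with I {} \<le> D_opt I"
      unfolding D_opt_def by (intro INF_greatest) simp
    also have "\<dots> \<le> enat 4 * D_opt I" by (cases "D_opt I") (simp_all add: numeral_eq_enat)
    finally have approx: "approx_solution (budget I) 4 I {}" by (simp add: approx_solution_def)
    have empty: "output_set s0 = {}" by (simp add: output_set_def s0)
    have small: "\<not> (1 \<le> budget I \<and> 1 \<le> n)" using True by (auto simp: k_def)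
    show ?thesis unfolding program_def run_Seq
    proof (rule run_mono[OF capacity[unfolded s0_def]], fold s0_def, goal_cases)
      case (1 t s)
      then have s: "s = ?s" by simp
      show ?case unfolding s using approx empty small True by (simp add: run_simps flip: n_def)
    qed
  next
    case False
    then have n1: "n \<ge> 1" and k: "1 \<le> k" "k \<le> n" "k \<le> budget I" by (auto simp: k_def)
    interpret graph n "edges I" "weight I" by unfold_locales (fact E n1)+
    have bv: "bval (Less (Const 0) (Scalar ''K'')) ?s" using k by simp
    show ?thesis unfolding program_def run_Seq
    proof (rule run_mono[OF capacity[unfolded s0_def]], fold s0_def, goal_cases)
      case (1 t1 s1)
      then have s1: "s1 = ?s" and t1: "t1 \<le> 20" by simp_all
      show ?case unfolding s1 run_If if_P[OF bv] run_Seq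
      proof (rule run_frame[OF run_rows], goal_cases)
        case (3 t2 s2)
        note post2 = 3(1) and frame2 = 3(2)
        have st2: "stored s2"
          using post2 by (simp add: stored_def frame2 s0 s0_E s0_w)
        show ?case
        proof (rule run_frame[OF run_bound[OF st2]], goal_cases)
          case (1 t3 s3)
          note post3 = 1(1) and frame3 = 1(2)
          have st3: "stored s3" by (rule stored_frame[OF st2]) (simp_all add: frame3)
          have eq3: "s3 ''K'' 0 = k" "s3 ''m'' 0 = 0" by (simp_all add: frame3 frame2 s0)
          show ?case
          proof (rule run_mono[OF run_main[OF st3 eq3(1) k(1,2) eq3(2)]], goal_cases)
            case 1
            show ?case using post3 by simp
          next
            case (2 t4 s4)
            let ?F = "output_set s4"
            have out: "?F \<subseteq> non_edges I" "card ?F \<le> k * k"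
              using 2 by (simp_all add: non_edges_def V)
            then have "(\<Sum>e\<in>?F. cost I e) = card ?F" by (intro cost) (auto simp: non_edges_def)
            also have "\<dots> \<le> budget I * budget I"
              using out(2) mult_le_mono[OF k(3) k(3)] by simp
            finally have "(\<Sum>e\<in>?F. cost I e) \<le> budget I * budget I" .
            moreover have "diameter_with I ?F \<le> enat 4 * D_opt I"
            \<comment> \<open>A finite optimum is attained, because \<open>enat\<close> is
              well-ordered and the empty set is feasible; an infinite one makes the bound
              trivial.\<close>
            proof (cases "D_opt I")
              case (enat r)
              have "feasible I {}" by (simp add: feasible_def)
              then have "D_opt I \<in> diameter_with I ` {F. feasible I F}"
                unfolding D_opt_def by (intro wellorder_InfI[of "diameter_with I {}"]) simp
              then obtain F where F: "feasible I F" "diameter_with I F = enat r"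
                using enat by auto
              have "F \<subseteq> [{..<n}]\<^bsup>2\<^esup>" using F(1) by (auto simp: feasible_def non_edges_def V)
              moreover have "card F \<le> k \<or> n \<le> k" using card_le[OF F(1)] by (auto simp: k_def)
              moreover have "diameter {..<n} (edges I \<union> F) (weight I) = enat r"
                using F(2) by (simp add: diameter_with_def V)
              ultimately have "diameter {..<n} (edges I \<union> ?F) (weight I) \<le> enat (4 * r)"
                using 2 by blast
              then show ?thesis using enat by (simp add: diameter_with_def V)
            qed simp
            ultimately have "approx_solution (budget I) 4 I ?F"
              using out(1) by (simp add: approx_solution_def)
            moreover have "t1 + t2 + t3 + t4 + 40 \<le> 3000 * (budget I * n ^ 2)"
            proof -
              have "n * n \<le> k * (n * n)" "n \<le> n * n" using k(1) n1 by simp_all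
              moreover have "k * (n * n) \<le> budget I * (n * n)" using k(3) by simp
              moreover have "t1 \<le> 20" "t2 \<le> 50 * n" "t3 \<le> 100 * (n * n)" "t4 \<le> 2400 * (k * (n * n))"
                using t1 post2 post3 2 by simp_all
              ultimately have "t1 + t2 + t3 + t4 + 40 \<le> 3000 * (budget I * (n * n))"
                using n1 by linarith
              then show ?thesis by (simp add: power2_eq_square)
            qed
            ultimately show ?case by (simp flip: n_def)
          qed
        qed
      qed (use s0 in \<open>simp_all\<close>)
    qed
  qed
qed

text \<open>The product of budget and squared order vanishes when either factor is 0, whereas every
  execution takes at least one time unit. The time bound is therefore stated for positive budget and
  at least one vertex, the approximation guarantee for all unit-cost instances.\<close>

theorem theorem4:
  shows "\<exists>p. approximation_algorithm unit_cost (\<lambda>I. budget I) (\<lambda>I. 4) p \<and>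
             (\<exists>C. runs_in_time (\<lambda>I. unit_cost I \<and> budget I \<ge> 1 \<and> card (verts I) \<ge> 1)
                    (\<lambda>I. C * (budget I * card (verts I) ^ 2)) p)"
proof (intro exI conjI)
  show "approximation_algorithm unit_cost (\<lambda>I. budget I) (\<lambda>I. 4) program"
    unfolding approximation_algorithm_def using run_program unfolding run_def by blast
  show "runs_in_time (\<lambda>I. unit_cost I \<and> budget I \<ge> 1 \<and> card (verts I) \<ge> 1)
          (\<lambda>I. 3000 * (budget I * card (verts I) ^ 2)) program"
    unfolding runs_in_time_def using run_program unfolding run_def by blast
qed

end
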